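(* Let $X$ be a finite dimensional Hilbert space, $x_0\in X$, $r\ge1$, $m\ge0$, and let $h_1,\dots,h_r:X\to\mathbb{R}\cup\{+\infty\}$ be proper closed convex functions. Let $g(x)=\frac{m+1}2\|x-x_0\|^2$, $\lambda_i=\frac1{m+1}$ for $i\in\{0,\dots,m\}$, and $h_j:=\lambda_{j-r}\,g=\frac12\|\cdot-x_0\|^2$ for $j\in\{r+1,\dots,r+m\}$. Let $\{z^{n,w}\}_{1\le n<\infty,\,0\le w\le\bar w}\subset X^{r+m}$ be generated by Algorithm A with Procedure I used for its step (b), and suppose the index condition (ABC) holds (Algorithm A, Procedure I and (ABC) are defined in the context). Suppose that: - the value $\alpha$ of the primal problem (P1) $\ \min_{x\in X}\sum_{i=1}^rh_i(x)+g(x)$ is finite, and let $\beta$ be the value of the dual problem $\max_{z\in X^{r+m}}F(z)$, with $F$ as in the context; - $\|z^{n,\bar w}\|\in O(\sqrt n)$; - minimizers can be obtained for the minimization problems in step (a) of Algorithm A and in Procedure I. For all $n\ge 1$ and $0\le w\le\bar w$ let $v^{n,w}:=\sum_{i=1}^{r+m}z_i^{n,w}$ and $x^{n,w}:=x_0-v^{n,w}$. Then: (i) The sum $$\sum_{n=1}^\infty\sum_{w=1}^{\bar w}\Big[\|v^{n,w}-v^{n,w-1}\|^2+\sum_{\substack{r+1\le j\le r+m\\ S'_{n,w,j}\ne\emptyset}}\|z_j^{n,w}-z_j^{n,w-1}\|^2\Big]$$ is finite, and $\{F(z^{n,\bar w})\}_{n=1}^\infty$ is nondecreasing. (ii) There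 is a constant $C$ such that $\|v^{n,w}\|^2\le C$ for all $n\in\mathbb{N}$ and $w\in\{1,\dots,\bar w\}$. (iii) Let $$\gamma_n:=\sum_{w=1}^{\bar w}\Big(\|v^{n,w}-v^{n,w-1}\|+\sum_{\substack{r+1\le j\le r+m\\ S'_{n,w,j}\ne\emptyset}}\|z_j^{n,w}-z_j^{n,w-1}\|\Big).$$ There exists a subsequence $\{v^{n_k,\bar w}\}_{k=1}^\infty$ of $\{v^{n,\bar w}\}_{n=1}^\infty$ which converges to some $v^*\in X$ and such that $\lim_{k\to\infty}\gamma_{n_k}\sqrt{n_k}=0$. (iv) For all $i\in\{1,\dots,r+m\}$ and $n\in\mathbb{N}$ there is $x_i^n\in\partial h_i^*(z_i^{n,\bar w})$ such that $\|x_i^n-(x_0-v^{n,\bar w})\|\le\gamma_n$. (v) For the $v^*$ in (iii), $x_0-v^*$ is the minimizer of the primal problem (P1), and $\lim_{k\to\infty}F(z^{n_k,\bar w})=\frac12\|v^*\|^2+\sum_{i=1}^{r+m}h_i(x_0-v^* )$. Moreover, $\lim_{n\to\infty}x^{n,\bar w}$ exists, and $x_0-v^*$ is the primal minimizer of (P1).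
   Context: $f^*$ denotes the Fenchel conjugate and $\partial f$ the convex subdifferential of $f$. The dual objective is $$F(z):=-\sum_{i=1}^{r+m}h_i^*(z_i)-\lambda_0\,g^*\Big(-\frac1{\lambda_0}\sum_{i=1}^{r+m}z_i\Big),\qquad z\in X^{r+m},$$ where, for the given $g$ and $\lambda_0$, $\lambda_0g^*(-\frac1{\lambda_0}y)=\frac12\|x_0-y\|^2-\frac12\|x_0\|^2$. Algorithm A (general framework for Dykstra's splitting; $\bar w$ is a fixed positive integer). Start with $\{z_i^{1,0}\}_{i=1}^{r+m}\subset X$. For $n=1,2,\dots$ and for $w=1,\dots,\bar w$: choose a (possibly empty) subset $S_{n,w}\subset\{1,\dots,r+m\}$; (a) let $\{z_i^{n,w}\}_{i\in S_{n,w}}$ be a minimizer of $$\min_{z_i:\,i\in S_{n,w}}\ \sum_{i\in S_{n,w}}h_i^*(z_i)+\lambda_0\,g^*\Big(-\frac1{\lambda_0}\Big[\sum_{i\in S_{n,w}}z_i+\sum_{i\notin S_{n,w}}z_i^{n,w-1}\Big]\Big);$$ (b) let $\{z_i^{n,w}\}_{i\notin S_{n,w}}$ be such that $\sum_{i\notin S_{n,w}}h_i^*(z_i^{n,w})\le\sum_{i\notin S_{n,w}}h_i^*(z_i^{n,w-1})$ and $\sum_{i\notin S_{n,w}}z_i^{n,w}=\sum_{i\notin S_{n,w}}z_i^{n,w-1}$. After the loop over $w$, set $z^{n+1,0}=z^{n,\bar w}$. Procedure I (a way of performing step (b)). Choose disjoint subsets $\{S'_{n,w,j}\}_{j=r+1}^{r+m}$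 such that $S_{n,w}\cap\bigcup_{j=r+1}^{r+m}S'_{n,w,j}=\emptyset$ and, for all $j\in\{r+1,\dots,r+m\}$, $S'_{n,w,j}\subset\{1,\dots,r\}\cup\{j\}$, and $S'_{n,w,j}\ne\emptyset$ implies $S'_{n,w,j}\supsetneq\{j\}$. For each $j\in\{r+1,\dots,r+m\}$, let $$\{z_i^{n,w}\}_{i\in S'_{n,w,j}}\in\arg\min_{z_i:\,i\in S'_{n,w,j}}\ \sum_{i\in S'_{n,w,j}}h_i^*(z_i)\quad\text{s.t.}\quad\sum_{i\in S'_{n,w,j}}z_i=\sum_{i\in S'_{n,w,j}}z_i^{n,w-1}.$$ If $i\notin S_{n,w}\cup\bigcup_{j=r+1}^{r+m}S'_{n,w,j}$, set $z_i^{n,w}=z_i^{n,w-1}$. Condition (ABC). For each $n\ge1$ and $i\in\{1,\dots,r+m\}$ there is an index $p(n,i)\in\{1,\dots,\bar w\}$ such that: (A) for all $i\in\{1,\dots,r+m\}$: (i) $i\notin S_{n,w}$ and $i\notin S'_{n,w,j}$ for all $w\in\{p(n,i)+1,\dots,\bar w\}$ and $j\in\{r+1,\dots,r+m\}$; and (ii) either $i\in S_{n,p(n,i)}$, or $i\in S'_{n,p(n,i),j}$ for some $j\in\{r+1,\dots,r+m\}$. (B) If $i\in\{1,\dots,r+m\}$ and $i\in S'_{n,p(n,i),j}$ for some (unique) $j\in\{r+1,\dots,r+m\}$ (including the case $i=j$), then there is some $q(n,i)\in\{1,\dots,p(n,i)-1\}$ such that $j\in S_{n,q(n,i)}$, and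 $S'_{n,p(n,i),j}\cap S_{n,w}=\emptyset$ and $S'_{n,p(n,i),j}\cap S'_{n,w,j'}=\emptyset$ for all $w\in\{q(n,i)+1,\dots,p(n,i)-1\}$ and $j'\in\{r+1,\dots,r+m\}$. *)

theory Defs
  imports "HOL-Analysis.Analysis" "HOL-Library.Landau_Symbols"
begin

text \<open>
  Tuples in \<open>X\<^sup>N\<close> are functions \<open>nat \<Rightarrow> 'a\<close> of which only the values on \<open>{1..N}\<close> matter.
  Functions with values in the reals and \<open>+\<infinity>\<close> are modelled as \<open>ereal\<close>-valued functions;
  properness excludes the value \<open>-\<infinity>\<close>.
\<close>

definition epi :: "('a \<Rightarrow> ereal) \<Rightarrow> ('a \<times> real) set" where
  "epi f = {(x, t). f x \<le> ereal t}"

definition proper_fun :: "('a \<Rightarrow> ereal) \<Rightarrow> bool" where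
  "proper_fun f \<longleftrightarrow> (\<forall>x. f x \<noteq> -\<infinity>) \<and> (\<exists>x. f x \<noteq> \<infinity>)"

definition closed_fun :: "('a::topological_space \<Rightarrow> ereal) \<Rightarrow> bool" where
  "closed_fun f \<longleftrightarrow> closed (epi f)"

definition convex_fun :: "('a::real_vector \<Rightarrow> ereal) \<Rightarrow> bool" where
  "convex_fun f \<longleftrightarrow> convex (epi f)"

definition fenchel_conj :: "('a::real_inner \<Rightarrow> ereal) \<Rightarrow> 'a \<Rightarrow> ereal" where
  "fenchel_conj f y = (SUP x. ereal (y \<bullet> x) - f x)"

definition subdifferential :: "('a::real_inner \<Rightarrow> ereal) \<Rightarrow> 'a \<Rightarrow> 'a set" where
  "subdifferential f x =
     {s. \<bar>f x\<bar> \<noteq> \<infinity> \<and> (\<forall>y. f x + ereal (s \<bullet> (y - x)) \<le> f y)}"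

definition primal_objective ::
    "nat \<Rightarrow> (nat \<Rightarrow> 'a \<Rightarrow> ereal) \<Rightarrow> ('a \<Rightarrow> real) \<Rightarrow> 'a \<Rightarrow> ereal" where
  "primal_objective r h g x = (\<Sum>i=1..r. h i x) + ereal (g x)"

definition dual_objective ::
    "nat \<Rightarrow> (nat \<Rightarrow> 'a::real_inner \<Rightarrow> ereal) \<Rightarrow> ('a \<Rightarrow> real) \<Rightarrow> real \<Rightarrow> (nat \<Rightarrow> 'a) \<Rightarrow> ereal" where
  "dual_objective N h g l0 z =
     - (\<Sum>i=1..N. fenchel_conj (h i) (z i))
     - ereal l0 * fenchel_conj (\<lambda>x. ereal (g x)) (- (1 / l0) *\<^sub>R (\<Sum>i=1..N. z i))"

text \<open>
  The objective of step (a), for the previous iterate \<open>u\<close> and the chosen subset \<open>T\<close>.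
  It depends only on the components of \<open>y\<close> with index in \<open>T\<close>.
\<close>

definition step_a_objective ::
    "nat \<Rightarrow> (nat \<Rightarrow> 'a::real_inner \<Rightarrow> ereal) \<Rightarrow> ('a \<Rightarrow> real) \<Rightarrow> real \<Rightarrow> nat set \<Rightarrow> (nat \<Rightarrow> 'a)
     \<Rightarrow> (nat \<Rightarrow> 'a) \<Rightarrow> ereal" where
  "step_a_objective N h g l0 T u y =
     (\<Sum>i\<in>T. fenchel_conj (h i) (y i))
     + ereal l0 * fenchel_conj (\<lambda>x. ereal (g x))
         (- (1 / l0) *\<^sub>R ((\<Sum>i\<in>T. y i) + (\<Sum>i\<in>{1..N} - T. u i)))"

text \<open>
  \<open>algorithm_A N h g l0 wbar S z\<close>: the array \<open>z n w i\<close>, for \<open>n \<ge> 1\<close>, \<open>0 \<le> w \<le> wbar\<close> and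
  \<open>1 \<le> i \<le> N\<close>, is generated by the algorithm with the choices \<open>S n w\<close>. The starting point
  \<open>z 1 0\<close> is unconstrained.
\<close>

definition algorithm_A ::
    "nat \<Rightarrow> (nat \<Rightarrow> 'a::real_inner \<Rightarrow> ereal) \<Rightarrow> ('a \<Rightarrow> real) \<Rightarrow> real \<Rightarrow> nat
     \<Rightarrow> (nat \<Rightarrow> nat \<Rightarrow> nat set) \<Rightarrow> (nat \<Rightarrow> nat \<Rightarrow> nat \<Rightarrow> 'a) \<Rightarrow> bool" where
  "algorithm_A N h g l0 wbar S z \<longleftrightarrow>
     (\<forall>n\<ge>1.
       (\<forall>w\<in>{1..wbar}.
          S n w \<subseteq> {1..N} \<and>
          is_arg_min (step_a_objective N h g l0 (S n w) (z n (w - 1))) (\<lambda>_. True) (z n w) \<and>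
          (\<Sum>i\<in>{1..N} - S n w. fenchel_conj (h i) (z n w i))
            \<le> (\<Sum>i\<in>{1..N} - S n w. fenchel_conj (h i) (z n (w - 1) i)) \<and>
          (\<Sum>i\<in>{1..N} - S n w. z n w i) = (\<Sum>i\<in>{1..N} - S n w. z n (w - 1) i)) \<and>
       (\<forall>i\<in>{1..N}. z (Suc n) 0 i = z n wbar i))"

definition procedure_I ::
    "nat \<Rightarrow> nat \<Rightarrow> (nat \<Rightarrow> 'a::real_inner \<Rightarrow> ereal) \<Rightarrow> nat \<Rightarrow> (nat \<Rightarrow> nat \<Rightarrow> nat set)
     \<Rightarrow> (nat \<Rightarrow> nat \<Rightarrow> nat \<Rightarrow> nat set) \<Rightarrow> (nat \<Rightarrow> nat \<Rightarrow> nat \<Rightarrow> 'a) \<Rightarrow> bool" where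
  "procedure_I r m h wbar S S' z \<longleftrightarrow>
     (\<forall>n\<ge>1. \<forall>w\<in>{1..wbar}.
        disjoint_family_on (S' n w) {r+1..r+m} \<and>
        S n w \<inter> (\<Union>j\<in>{r+1..r+m}. S' n w j) = {} \<and>
        (\<forall>j\<in>{r+1..r+m}.
           S' n w j \<subseteq> {1..r} \<union> {j} \<and>
           (S' n w j \<noteq> {} \<longrightarrow> {j} \<subset> S' n w j) \<and>
           is_arg_min (\<lambda>y. \<Sum>i\<in>S' n w j. fenchel_conj (h i) (y i))
             (\<lambda>y. (\<Sum>i\<in>S' n w j. y i) = (\<Sum>i\<in>S' n w j. z n (w - 1) i))
             (z n w)) \<and>
        (\<forall>i\<in>{1..r+m}. i \<notin> S n w \<union> (\<Union>j\<in>{r+1..r+m}. S' n w j) \<longrightarrow>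
           z n w i = z n (w - 1) i))"

text \<open>In the following two conditions, \<open>p\<close> plays the role of \<open>p(n,i)\<close> and \<open>q\<close> that of \<open>q(n,i)\<close>.\<close>

definition condition_A ::
    "nat \<Rightarrow> nat \<Rightarrow> nat \<Rightarrow> (nat \<Rightarrow> nat \<Rightarrow> nat set) \<Rightarrow> (nat \<Rightarrow> nat \<Rightarrow> nat \<Rightarrow> nat set)
     \<Rightarrow> nat \<Rightarrow> nat \<Rightarrow> nat \<Rightarrow> bool" where
  "condition_A r m wbar S S' n i p \<longleftrightarrow>
     (\<forall>w\<in>{p+1..wbar}. i \<notin> S n w \<and> (\<forall>j\<in>{r+1..r+m}. i \<notin> S' n w j)) \<and>
     (i \<in> S n p \<or> (\<exists>j\<in>{r+1..r+m}. i \<in> S' n p j))"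

definition condition_B ::
    "nat \<Rightarrow> nat \<Rightarrow> (nat \<Rightarrow> nat \<Rightarrow> nat set) \<Rightarrow> (nat \<Rightarrow> nat \<Rightarrow> nat \<Rightarrow> nat set)
     \<Rightarrow> nat \<Rightarrow> nat \<Rightarrow> nat \<Rightarrow> bool" where
  "condition_B r m S S' n i p \<longleftrightarrow>
     (\<forall>j\<in>{r+1..r+m}. i \<in> S' n p j \<longrightarrow>
        (\<exists>q\<in>{1..p-1}. j \<in> S n q \<and>
           (\<forall>w\<in>{q+1..p-1}. S' n p j \<inter> S n w = {} \<and>
              (\<forall>j'\<in>{r+1..r+m}. S' n p j \<inter> S' n w j' = {}))))"

definition condition_ABC ::
    "nat \<Rightarrow> nat \<Rightarrow> nat \<Rightarrow> (nat \<Rightarrow> nat \<Rightarrow> nat set) \<Rightarrow> (nat \<Rightarrow> nat \<Rightarrow> nat \<Rightarrow> nat set) \<Rightarrow> bool" where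
  "condition_ABC r m wbar S S' \<longleftrightarrow>
     (\<forall>n\<ge>1. \<forall>i\<in>{1..r+m}. \<exists>p\<in>{1..wbar}.
        condition_A r m wbar S S' n i p \<and> condition_B r m S S' n i p)"

end

theory Submission
  imports Defs
begin

text \<open>
  Every update of the algorithm is an exact minimization of convex functions to which one smooth,
  strongly convex term is coupled, so its minimizer solves an inclusion. After a step of type (a)
  the point \<open>x0 - v\<close>, where \<open>v\<close> is the sum of all components, is a subgradient of \<open>fenchel_conj (h i)\<close>
  at the new component for every \<open>i\<close> in the updated set (\<open>subgradient_on_S\<close>). In a block \<open>S' n w j\<close>
  of Procedure I the components trade mass with the component \<open>j\<close>, whose conjugate
  is quadratic with gradient \<open>y \<mapsto> x0 + y\<close>; hence \<open>x0 + z n w j\<close> is a common subgradient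
  (\<open>subgradient_on_S'\<close>). Adding these subgradient inequalities, the exact second order
  remainders of the quadratic terms show that the dual value grows in each step by at least half of
  the squared increments (\<open>dual_value_step\<close>). Weak duality bounds the dual values by the primal value,
  so the squared increments are summable, and completing the square in the duality gap
  (\<open>duality_gap\<close>) confines \<open>v\<close> to a ball.

  By the index condition each component was last touched at a moment when its subgradient was either
  \<open>x0 - v\<close> or \<open>x0 + z j\<close> with \<open>z j\<close> close to \<open>- v\<close>. Consequently at the end of cycle \<open>n\<close> there are
  subgradients \<open>\<xi> i\<close> of all conjugates, all within \<open>increment n\<close> of \<open>x0 - v n wbar\<close>
  (\<open>subgradient_near\<close>). Summability of \<open>(increment n)\<^sup>2\<close> against the divergence of the harmonic series
  gives a subsequence with \<open>increment n * sqrt n\<close> tending to zero (\<open>good_subsequence\<close>). Fenchel's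
  equality \<open>h i (\<xi> i) + fenchel_conj (h i) (z i) = z i \<bullet> \<xi> i\<close> (Fenchel--Moreau, \<open>subdifferential_fenchel_conj_le\<close>)
  turns the dual value into the primal value at the \<open>\<xi> i\<close> plus the error
  \<open>\<Sum>i. z i \<bullet> (\<xi> i - (x0 - v))\<close>; the growth bound on \<open>z\<close> makes this error vanish along the
  subsequence. Lower semicontinuity then yields that the primal value at the limit of \<open>x0 - v\<close> is at most
  the limit of the dual values, so there is no duality gap and that limit is a minimizer
  (\<open>limit_attains_primal_value\<close>).

  Since the dual values increase, they converge to the primal value along the whole
  sequence. The square in \<open>duality_gap\<close> then forces \<open>x0 - v n wbar\<close> to converge to every primal minimizer
  (\<open>minimizer_is_limit\<close>), which gives uniqueness of the minimizer and convergence of the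
  full sequence at once.
\<close>

section \<open>Fenchel conjugates of closed convex functions\<close>

lemma fenchel_conj_le_iff:
  assumes "\<And>x. f x \<noteq> -\<infinity>"
  shows "fenchel_conj f y \<le> ereal c \<longleftrightarrow> (\<forall>x. ereal (y \<bullet> x - c) \<le> f x)"
proof -
  have "ereal (y \<bullet> x) - f x \<le> ereal c \<longleftrightarrow> ereal (y \<bullet> x - c) \<le> f x" for x
    using assms[of x] by (cases "f x") auto
  then show ?thesis
    unfolding fenchel_conj_def by (simp add: SUP_le_iff)
qed

lemma fenchel_young:
  assumes "\<And>x. f x \<noteq> -\<infinity>" and "fenchel_conj f y = ereal c"
  shows "ereal (y \<bullet> x - c) \<le> f x"
  using fenchel_conj_le_iff[of f y c] assms by simp

text \<open>
  The epigraph is an intersection of half-spaces, by the previous characterization of the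
  sublevel sets.
\<close>

lemma convex_fun_fenchel_conj:
  assumes "\<And>x. f x \<noteq> -\<infinity>"
  shows "convex_fun (fenchel_conj f)"
  unfolding convex_fun_def
proof (rule convexI, clarsimp simp: epi_def fenchel_conj_le_iff[OF assms])
  fix y1 y2 c1 c2 and u v :: real and x
  assume 1: "\<forall>x. ereal (y1 \<bullet> x - c1) \<le> f x" "\<forall>x. ereal (y2 \<bullet> x - c2) \<le> f x"
    and uv: "0 \<le> u" "0 \<le> v" "u + v = 1"
  show "ereal ((u *\<^sub>R y1 + v *\<^sub>R y2) \<bullet> x - (u * c1 + v * c2)) \<le> f x"
  proof (cases "f x")
    case (real b)
    have le: "y1 \<bullet> x - c1 \<le> b" "y2 \<bullet> x - c2 \<le> b"
      using 1[THEN spec, of x] real by auto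
    have "(u *\<^sub>R y1 + v *\<^sub>R y2) \<bullet> x - (u * c1 + v * c2) = u * (y1 \<bullet> x - c1) + v * (y2 \<bullet> x - c2)"
      by (simp add: algebra_simps)
    also have "\<dots> \<le> b"
      using convex_bound_le[OF le uv] .
    finally show ?thesis using real by simp
  qed (use assms[of x] in auto)
qed

text \<open>
  This is the Fenchel--Moreau theorem in the form in which it is used: the point \<open>(x, t)\<close> below the graph
  is strictly separated from the closed convex epigraph, and a non-vertical separating hyperplane
  is the graph of an affine minorant. A vertical one can occur only where \<open>f x\<close> is infinite; there it is
  added, with a large factor, to an arbitrary affine minorant.
\<close>

lemma affine_minorant:
  fixes f :: "'a::euclidean_space \<Rightarrow> ereal"
  assumes "proper_fun f" "closed_fun f" "convex_fun f" and t: "ereal t < f x"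
  obtains y c where "\<And>u. ereal (y \<bullet> u - c) \<le> f u" and "t < y \<bullet> x - c"
proof -
  have f: "f u \<noteq> -\<infinity>" for u
    using assms(1) by (auto simp: proper_fun_def)
  obtain x1 t1 where x1: "f x1 = ereal t1"
    using assms(1) unfolding proper_fun_def by (metis ereal_cases)
  have sep: "\<exists>y s b. y \<bullet> a + s * \<tau> < b \<and> s \<ge> 0 \<and> (\<forall>u \<sigma>. f u \<le> ereal \<sigma> \<longrightarrow> b < y \<bullet> u + s * \<sigma>)"
    if lt: "ereal \<tau> < f a" for a \<tau>
  proof -
    have "(a, \<tau>) \<notin> epi f"
      using lt by (auto simp: epi_def)
    then obtain ys b where ysb: "ys \<bullet> (a, \<tau>) < b" "\<forall>p\<in>epi f. b < ys \<bullet> p"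
      using separating_hyperplane_closed_point[of "epi f" "(a, \<tau>)"] assms(2,3)
      by (auto simp: closed_fun_def convex_fun_def)
    obtain y s where ys: "ys = (y, s)" by (cases ys)
    have sep: "y \<bullet> a + s * \<tau> < b" "\<And>u \<sigma>. f u \<le> ereal \<sigma> \<Longrightarrow> b < y \<bullet> u + s * \<sigma>"
      using ysb by (auto simp: ys epi_def)
    have "s \<ge> 0"
    proof (rule ccontr)
      assume "\<not> s \<ge> 0"
      then have s: "s < 0" by simp
      \<comment> \<open>Far enough up the vertical ray over \<open>x1\<close> the linear form would drop below \<open>b\<close>.\<close>
      define \<sigma> where "\<sigma> = max t1 ((b - y \<bullet> x1) / s)"
      have "f x1 \<le> ereal \<sigma>" by (simp add: x1 \<sigma>_def)
      then have "b < y \<bullet> x1 + s * \<sigma>" by (rule sep)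
      moreover have "s * \<sigma> \<le> s * ((b - y \<bullet> x1) / s)"
        using s by (intro mult_left_mono_neg) (auto simp: \<sigma>_def)
      ultimately show False using s by simp
    qed
    then show ?thesis using sep by blast
  qed
  have nonvertical: "\<exists>y' c'. (\<forall>u. ereal (y' \<bullet> u - c') \<le> f u) \<and> \<tau> < y' \<bullet> a - c'"
    if s: "s > 0" and at: "y \<bullet> a + s * \<tau> < b"
      and above: "\<forall>u \<sigma>. f u \<le> ereal \<sigma> \<longrightarrow> b < y \<bullet> u + s * \<sigma>" for y s b a \<tau>
  proof (intro exI conjI allI)
    fix u
    show "ereal ((- (1 / s) *\<^sub>R y) \<bullet> u - (- b / s)) \<le> f u"
    proof (cases "f u")
      case (real \<sigma>)
      then have "b < y \<bullet> u + s * \<sigma>" using above by simp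
      then show ?thesis using s real by (simp add: field_simps)
    qed (use f[of u] in auto)
  next
    show "\<tau> < (- (1 / s) *\<^sub>R y) \<bullet> a - (- b / s)"
      using at s by (simp add: field_simps)
  qed
  obtain y s b where ysb: "y \<bullet> x + s * t < b" "s \<ge> 0"
      "\<forall>u \<sigma>. f u \<le> ereal \<sigma> \<longrightarrow> b < y \<bullet> u + s * \<sigma>"
    using sep[OF t] by blast
  show thesis
  proof (cases "s = 0")
    case False
    then show thesis using nonvertical[of s y x t b] ysb that by auto
  next
    case s0: True
    \<comment> \<open>A vertical hyperplane carries no minorant itself; it is used to tilt one taken at \<open>x1\<close>.\<close>
    have "ereal (t1 - 1) < f x1" by (simp add: x1)
    then obtain y1 s1 b1 where 1: "y1 \<bullet> x1 + s1 * (t1 - 1) < b1" "s1 \<ge> 0"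
        "\<forall>u \<sigma>. f u \<le> ereal \<sigma> \<longrightarrow> b1 < y1 \<bullet> u + s1 * \<sigma>"
      using sep by blast
    have "b1 < y1 \<bullet> x1 + s1 * t1" using 1 x1 by simp
    with 1 have "s1 \<noteq> 0" by auto
    then obtain y2 c2 where y2: "\<And>u. ereal (y2 \<bullet> u - c2) \<le> f u"
      using nonvertical[of s1 y1 x1 "t1 - 1" b1] 1 by auto
    define k where "k = \<bar>t - (y2 \<bullet> x - c2)\<bar> / (b - y \<bullet> x) + 1"
    have pos: "b - y \<bullet> x > 0" using ysb s0 by simp
    have k: "k > 0" unfolding k_def using pos by (auto intro!: add_nonneg_pos)
    show thesis
    proof (rule that[of "y2 - k *\<^sub>R y" "c2 - k * b"])
      fix u
      show "ereal ((y2 - k *\<^sub>R y) \<bullet> u - (c2 - k * b)) \<le> f u"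
      proof (cases "f u")
        case (real \<sigma>)
        have "b \<le> y \<bullet> u" using ysb(3)[rule_format, of u \<sigma>] real s0 by simp
        then have "k * b \<le> k * (y \<bullet> u)" using k by simp
        moreover have "y2 \<bullet> u - c2 \<le> \<sigma>" using y2[of u] real by simp
        ultimately show ?thesis by (simp add: real inner_diff_left)
      qed (use f[of u] in auto)
    next
      have "k * (b - y \<bullet> x) = \<bar>t - (y2 \<bullet> x - c2)\<bar> + (b - y \<bullet> x)"
        using pos by (simp add: k_def field_simps)
      then show "t < (y2 - k *\<^sub>R y) \<bullet> x - (c2 - k * b)"
        using pos by (simp add: inner_diff_left algebra_simps)
    qed
  qed
qed

lemma proper_fun_fenchel_conj:
  fixes f :: "'a::euclidean_space \<Rightarrow> ereal"
  assumes "proper_fun f" "closed_fun f" "convex_fun f"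
  shows "proper_fun (fenchel_conj f)"
proof -
  have f: "f u \<noteq> -\<infinity>" for u
    using assms(1) by (auto simp: proper_fun_def)
  obtain x1 t1 where x1: "f x1 = ereal t1"
    using assms(1) unfolding proper_fun_def by (metis ereal_cases)
  have "fenchel_conj f y \<noteq> -\<infinity>" for y
  proof -
    have "ereal (y \<bullet> x1) - f x1 \<le> fenchel_conj f y"
      unfolding fenchel_conj_def by (rule SUP_upper) simp
    then show ?thesis by (auto simp: x1)
  qed
  moreover have "\<exists>y. fenchel_conj f y \<noteq> \<infinity>"
  proof -
    have "ereal (t1 - 1) < f x1" by (simp add: x1)
    then obtain y c where "\<And>u. ereal (y \<bullet> u - c) \<le> f u"
      using affine_minorant[OF assms] by blast
    then have "fenchel_conj f y \<le> ereal c"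
      by (simp add: fenchel_conj_le_iff[of f, OF f])
    then show ?thesis by (metis ereal_infty_less_eq(1) PInfty_neq_ereal(1))
  qed
  ultimately show ?thesis by (simp add: proper_fun_def)
qed

text \<open>
  The inclusion \<open>s \<in> \<partial>f\<^sup>*(y)\<close> gives an upper bound for the biconjugate at \<open>s\<close>. If \<open>f s\<close> were larger, an
  affine minorant of \<open>f\<close> exceeding the bound at \<open>s\<close> would have a slope at which the subgradient inequality
  fails. Together with \<open>fenchel_young\<close> it is the equality case of Fenchel's inequality.
\<close>

lemma subdifferential_fenchel_conj_le:
  fixes f :: "'a::euclidean_space \<Rightarrow> ereal"
  assumes "proper_fun f" "closed_fun f" "convex_fun f"
    and s: "s \<in> subdifferential (fenchel_conj f) y" and c: "fenchel_conj f y = ereal c"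
  shows "f s \<le> ereal (y \<bullet> s - c)"
proof (rule ccontr)
  have f: "f u \<noteq> -\<infinity>" for u
    using assms(1) by (auto simp: proper_fun_def)
  assume "\<not> ?thesis"
  then have "ereal (y \<bullet> s - c) < f s" by simp
  then obtain y' c' where "\<And>u. ereal (y' \<bullet> u - c') \<le> f u" and lt: "y \<bullet> s - c < y' \<bullet> s - c'"
    using affine_minorant[OF assms(1-3)] by blast
  then have "fenchel_conj f y' \<le> ereal c'"
    by (simp add: fenchel_conj_le_iff[of f, OF f])
  moreover have "ereal c + ereal (s \<bullet> (y' - y)) \<le> fenchel_conj f y'"
    using s c by (auto simp: subdifferential_def)
  ultimately have "ereal c + ereal (s \<bullet> (y' - y)) \<le> ereal c'" by (rule order_trans[rotated])
  then show False
    using lt by (simp add: inner_diff_right inner_commute)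
qed

lemma closed_fun_less_eventually:
  fixes f :: "'a::metric_space \<Rightarrow> ereal"
  assumes "closed_fun f" and X: "X \<longlonglongrightarrow> x" and t: "ereal t < f x"
  shows "\<forall>\<^sub>F k in sequentially. ereal t < f (X k)"
proof -
  have "(\<lambda>k. (X k, t)) \<longlonglongrightarrow> (x, t)"
    by (intro tendsto_Pair X tendsto_const)
  moreover have "open (- epi f)" "(x, t) \<in> - epi f"
    using assms by (auto simp: closed_fun_def epi_def)
  ultimately have "\<forall>\<^sub>F k in sequentially. (X k, t) \<in> - epi f"
    by (rule topological_tendstoD)
  then show ?thesis by (simp add: epi_def not_le)
qed

lemma fenchel_conj_quadratic:
  fixes x0 :: "'a::real_inner"
  assumes c: "c > 0"
  shows "fenchel_conj (\<lambda>x. ereal (c / 2 * (norm (x - x0))\<^sup>2)) y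
    = ereal (y \<bullet> x0 + (norm y)\<^sup>2 / (2 * c))"
  unfolding fenchel_conj_def
proof (rule antisym)
  have sq: "y \<bullet> x0 + (norm y)\<^sup>2 / (2 * c) - (y \<bullet> x - c / 2 * (norm (x - x0))\<^sup>2)
      = c / 2 * (norm (x - x0 - (1 / c) *\<^sub>R y))\<^sup>2" for x
  proof -
    define d where "d = x - x0"
    have "(norm (d - (1 / c) *\<^sub>R y))\<^sup>2 = (norm d)\<^sup>2 - 2 / c * (y \<bullet> d) + (norm y)\<^sup>2 / c\<^sup>2"
      unfolding power2_norm_eq_inner
      by (simp add: inner_diff_left inner_diff_right inner_commute power2_eq_square)
    then have "c / 2 * (norm (d - (1 / c) *\<^sub>R y))\<^sup>2
        = c / 2 * (norm d)\<^sup>2 - y \<bullet> d + (norm y)\<^sup>2 / (2 * c)"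
      using c by (simp add: field_simps power2_eq_square)
    moreover have "y \<bullet> x = y \<bullet> x0 + y \<bullet> d"
      by (simp add: d_def inner_diff_right)
    ultimately show ?thesis by (simp add: d_def)
  qed
  show "(SUP x. ereal (y \<bullet> x) - ereal (c / 2 * (norm (x - x0))\<^sup>2))
      \<le> ereal (y \<bullet> x0 + (norm y)\<^sup>2 / (2 * c))"
  proof (rule SUP_least)
    fix x
    have "c / 2 * (norm (x - x0 - (1 / c) *\<^sub>R y))\<^sup>2 \<ge> 0"
      using c by simp
    then show "ereal (y \<bullet> x) - ereal (c / 2 * (norm (x - x0))\<^sup>2) \<le> ereal (y \<bullet> x0 + (norm y)\<^sup>2 / (2 * c))"
      using sq[of x] by simp
  qed
  \<comment> \<open>The supremum is attained where the completed square vanishes.\<close>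
  show "ereal (y \<bullet> x0 + (norm y)\<^sup>2 / (2 * c))
      \<le> (SUP x. ereal (y \<bullet> x) - ereal (c / 2 * (norm (x - x0))\<^sup>2))"
    by (rule SUP_upper2[of "x0 + (1 / c) *\<^sub>R y"]) (use sq[of "x0 + (1 / c) *\<^sub>R y"] in auto)
qed

text \<open>
  The optimality condition behind every step: where the sum of a convex function and a quadratic is minimal,
  the negative gradient of the quadratic is a subgradient of the function. On a segment of length \<open>t\<close>,
  convexity scales with \<open>t\<close> while the pure square scales with \<open>t\<^sup>2\<close> and drops out.
\<close>

lemma subgradient_of_quadratic_minorant:
  fixes f :: "'a::real_inner \<Rightarrow> ereal"
  assumes f: "convex_fun f" and fin: "\<bar>f y\<bar> \<noteq> \<infinity>"
    and min: "\<And>d. f y \<le> f (y + d) + ereal ((norm d)\<^sup>2 / 2 - s \<bullet> d)"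
  shows "s \<in> subdifferential f y"
proof -
  obtain a where a: "f y = ereal a" using fin by auto
  have "f y + ereal (s \<bullet> (u - y)) \<le> f u" for u
  proof (rule ereal_le_real, rule ccontr)
    fix \<beta> assume \<beta>: "f u \<le> ereal \<beta>"
    define d where "d = u - y"
    define K where "K = a + s \<bullet> d - \<beta>"
    assume "\<not> f y + ereal (s \<bullet> (u - y)) \<le> ereal \<beta>"
    then have K: "K > 0" by (simp add: a K_def d_def)
    \<comment> \<open>On the segment the gain is linear and the quadratic term is of second order: a short
      step contradicts minimality.\<close>
    define t where "t = min 1 (K / ((norm d)\<^sup>2 + 1))"
    have nz: "(norm d)\<^sup>2 + 1 > 0" by (simp add: add_nonneg_pos)
    have t: "0 < t" "t \<le> 1" using K nz by (auto simp: t_def)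
    have "t * (norm d)\<^sup>2 \<le> K / ((norm d)\<^sup>2 + 1) * (norm d)\<^sup>2"
      by (intro mult_right_mono) (auto simp: t_def)
    also have "\<dots> \<le> K" using K nz by (simp add: field_simps)
    finally have tK: "t * (norm d)\<^sup>2 \<le> K" .
    have "(1 - t) *\<^sub>R (y, a) + t *\<^sub>R (u, \<beta>) \<in> epi f"
      using f[unfolded convex_fun_def] a \<beta> t by (intro convexD) (auto simp: epi_def)
    then have "f (y + t *\<^sub>R d) \<le> ereal ((1 - t) * a + t * \<beta>)"
      by (simp add: epi_def d_def algebra_simps)
    then have "f (y + t *\<^sub>R d) + ereal ((norm (t *\<^sub>R d))\<^sup>2 / 2 - s \<bullet> (t *\<^sub>R d))
        \<le> ereal ((1 - t) * a + t * \<beta>) + ereal ((norm (t *\<^sub>R d))\<^sup>2 / 2 - s \<bullet> (t *\<^sub>R d))"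
      by (rule add_right_mono)
    with min[of "t *\<^sub>R d"] have "f y \<le> \<dots>" by (rule order_trans)
    then have "a \<le> (1 - t) * a + t * \<beta> + (t\<^sup>2 * (norm d)\<^sup>2 / 2 - t * (s \<bullet> d))"
      using t by (simp add: a power_mult_distrib)
    then have "t * K \<le> t * (t * (norm d)\<^sup>2 / 2)"
      by (simp add: K_def algebra_simps power2_eq_square)
    then have "K \<le> t * (norm d)\<^sup>2 / 2" using t by simp
    with tK K show False by simp
  qed
  then show ?thesis using fin by (simp add: subdifferential_def)
qed

section \<open>Sequences of real numbers and vectors\<close>

text \<open>
  Lower semicontinuity of a finite sum: the summands may oscillate as long as their sum converges, since
  lower limits are superadditive.
\<close>

lemma sum_le_of_lower_semicontinuous_limits:
  fixes u :: "'i \<Rightarrow> nat \<Rightarrow> real" and a :: "'i \<Rightarrow> ereal"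
  assumes "finite I"
    and lsc: "\<And>i t. i \<in> I \<Longrightarrow> ereal t < a i \<Longrightarrow> \<forall>\<^sub>F k in sequentially. t < u i k"
    and a: "\<And>i. i \<in> I \<Longrightarrow> a i \<noteq> -\<infinity>"
    and lim: "(\<lambda>k. \<Sum>i\<in>I. u i k) \<longlonglongrightarrow> L"
  shows "(\<Sum>i\<in>I. a i) \<le> ereal L"
proof -
  have a_le: "a i \<le> liminf (\<lambda>k. ereal (u i k))" if "i \<in> I" for i
  proof (rule dense_le)
    fix t assume "t < a i"
    show "t \<le> liminf (\<lambda>k. ereal (u i k))"
    proof (cases t)
      case (real b)
      then have "\<forall>\<^sub>F k in sequentially. t \<le> ereal (u i k)"
        using lsc[OF that, of b] \<open>t < a i\<close> by (auto elim!: eventually_mono)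
      then show ?thesis by (rule Liminf_bounded)
    qed (use \<open>t < a i\<close> in auto)
  qed
  have "(\<Sum>i\<in>J. a i) \<le> liminf (\<lambda>k. \<Sum>i\<in>J. ereal (u i k)) \<and> (\<Sum>i\<in>J. a i) \<noteq> -\<infinity>" if "J \<subseteq> I" for J
    using finite_subset[OF that \<open>finite I\<close>] that
  proof (induction J)
    case empty
    then show ?case by (simp add: Liminf_const)
  next
    case (insert i J)
    let ?ui = "\<lambda>k. ereal (u i k)" and ?uJ = "\<lambda>k. \<Sum>i\<in>J. ereal (u i k)"
    have IH: "(\<Sum>i\<in>J. a i) \<le> liminf ?uJ" "(\<Sum>i\<in>J. a i) \<noteq> -\<infinity>"
      using insert by auto
    have i: "a i \<le> liminf ?ui" "a i \<noteq> -\<infinity>" using a_le a insert.prems by auto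
    have "a i + (\<Sum>i\<in>J. a i) \<le> liminf ?ui + liminf ?uJ"
      using IH i by (intro add_mono)
    also have "\<dots> \<le> liminf (\<lambda>k. ?ui k + ?uJ k)"
      using IH i by (intro ereal_liminf_add_mono) auto
    finally show ?case using insert IH i by simp
  qed
  from this[of I] have "(\<Sum>i\<in>I. a i) \<le> liminf (\<lambda>k. ereal (\<Sum>i\<in>I. u i k))"
    by simp
  also have "\<dots> = ereal L"
    using lim by (intro lim_imp_Liminf) auto
  finally show ?thesis .
qed

lemma strict_mono_selection:
  fixes Q :: "nat \<Rightarrow> nat \<Rightarrow> bool"
  assumes "\<And>k M. \<exists>n\<ge>M. Q k n"
  obtains s where "strict_mono s" "\<And>k. Q k (s k)"
proof -
  have "\<exists>s. \<forall>k. Q k (s k) \<and> s k < s (Suc k)"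
  proof (rule dependent_nat_choice)
    show "\<exists>n. Q 0 n" using assms[of 0 0] by blast
    show "\<exists>y. Q (Suc k) y \<and> n < y" for n k
      using assms[of "Suc n" "Suc k"] by (auto simp: Suc_le_eq)
  qed
  then show thesis using that by (auto simp: strict_mono_Suc_iff)
qed

text \<open>
  Otherwise \<open>f\<close> would dominate a multiple of the harmonic series.
\<close>

lemma summable_imp_small_multiple:
  fixes f :: "nat \<Rightarrow> real"
  assumes "summable f" and "c > 0"
  shows "\<exists>n\<ge>M. n \<ge> 1 \<and> real n * f n < c"
proof (rule ccontr)
  assume "\<not> ?thesis"
  then have ge: "c \<le> real n * f n" if "n \<ge> max M 1" for n
    using that by force
  have "norm (inverse (real n)) \<le> f n / c" if "n \<ge> max M 1" for n
    using ge[OF that] that \<open>c > 0\<close> by (simp add: field_simps)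
  then have "summable (\<lambda>n. inverse (real n))"
    by (intro summable_comparison_test'[OF summable_divide[OF assms(1)], of "max M 1"])
  then show False using not_summable_harmonic[where 'a = real] by simp
qed


lemma norm_diff_le_sum_increments:
  fixes f :: "nat \<Rightarrow> 'a::real_normed_vector"
  assumes "a \<le> b"
  shows "norm (f b - f a) \<le> (\<Sum>w=a+1..b. norm (f w - f (w - 1)))"
  using assms
proof (induction b rule: dec_induct)
  case (step b)
  have "norm (f (Suc b) - f a) \<le> norm (f (Suc b) - f b) + norm (f b - f a)"
    using norm_triangle_ineq[of "f (Suc b) - f b" "f b - f a"] by simp
  with step show ?case by simp
qed simp

section \<open>The half squared norm\<close>

lemma half_norm_sq_add: "(norm (a + d))\<^sup>2 / 2 = (norm a)\<^sup>2 / 2 + a \<bullet> d + (norm d)\<^sup>2 / 2"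
  for a d :: "'a::real_inner"
  by (simp add: power2_norm_eq_inner inner_add_left inner_add_right inner_commute)

lemma half_norm_sq_diff: "(norm (a - d))\<^sup>2 / 2 = (norm a)\<^sup>2 / 2 - a \<bullet> d + (norm d)\<^sup>2 / 2"
  for a d :: "'a::real_inner"
  using half_norm_sq_add[of a "- d"] by simp

lemma closed_fun_quadratic: "closed_fun (\<lambda>x. ereal (1 / 2 * (norm (x - a))\<^sup>2))"
  for a :: "'a::real_normed_vector"
  unfolding closed_fun_def epi_def case_prod_beta ereal_less_eq
  by (intro closed_Collect_le continuous_intros)

lemma convex_fun_quadratic: "convex_fun (\<lambda>x. ereal (1 / 2 * (norm (x - a))\<^sup>2))"
  for a :: "'a::real_inner"
  unfolding convex_fun_def
proof (rule convexI)
  fix p q :: "'a \<times> real" and u w :: real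
  assume pq: "p \<in> epi (\<lambda>x. ereal (1 / 2 * (norm (x - a))\<^sup>2))" "q \<in> epi (\<lambda>x. ereal (1 / 2 * (norm (x - a))\<^sup>2))"
    and uw: "0 \<le> u" "0 \<le> w" "u + w = 1"
  define b c where "b = fst p - a" and "c = fst q - a"
  have w: "w = 1 - u" using uw by simp
  have "fst (u *\<^sub>R p + w *\<^sub>R q) - a = c + u *\<^sub>R (b - c)"
    unfolding b_def c_def w by (simp add: algebra_simps)
  then have "(norm (fst (u *\<^sub>R p + w *\<^sub>R q) - a))\<^sup>2 / 2
      = (norm c)\<^sup>2 / 2 + u * (c \<bullet> (b - c)) + u\<^sup>2 * ((norm (b - c))\<^sup>2 / 2)"
    by (simp add: half_norm_sq_add power_mult_distrib)
  also have "\<dots> \<le> (norm c)\<^sup>2 / 2 + u * (c \<bullet> (b - c)) + u * ((norm (b - c))\<^sup>2 / 2)"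
    using uw by (intro add_left_mono mult_right_mono) (auto simp: power2_eq_square mult_left_le)
  also have "\<dots> = u * ((norm b)\<^sup>2 / 2) + w * ((norm c)\<^sup>2 / 2)"
  proof -
    have "c \<bullet> (b - c) + (norm (b - c))\<^sup>2 / 2 = (norm b)\<^sup>2 / 2 - (norm c)\<^sup>2 / 2"
      using half_norm_sq_add[of c "b - c"] by (simp add: field_simps)
    then have "u * (c \<bullet> (b - c)) + u * ((norm (b - c))\<^sup>2 / 2) = u * ((norm b)\<^sup>2 / 2 - (norm c)\<^sup>2 / 2)"
      by (metis distrib_left)
    then show ?thesis unfolding w by (simp add: left_diff_distrib right_diff_distrib diff_divide_distrib)
  qed
  also have "\<dots> \<le> u * snd p + w * snd q"
    using pq uw by (intro add_mono mult_left_mono) (auto simp: epi_def b_def c_def)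
  finally show "u *\<^sub>R p + w *\<^sub>R q \<in> epi (\<lambda>x. ereal (1 / 2 * (norm (x - a))\<^sup>2))"
    by (simp add: epi_def case_prod_beta)
qed

section \<open>Optimality and ascent in a single step\<close>

text \<open>
  The weights \<open>1 / (m + 1)\<close> are already inserted; they turn each multiple of \<open>g\<close> that occurs into half of
  the squared distance to \<open>x0\<close>.
\<close>

locale dykstra_splitting =
  fixes x0 :: "'a::euclidean_space"
    and r m wbar :: nat
    and h :: "nat \<Rightarrow> 'a \<Rightarrow> ereal"
    and S :: "nat \<Rightarrow> nat \<Rightarrow> nat set"
    and S' :: "nat \<Rightarrow> nat \<Rightarrow> nat \<Rightarrow> nat set"
    and z :: "nat \<Rightarrow> nat \<Rightarrow> nat \<Rightarrow> 'a"
  assumes closed_convex: "i \<in> {1..r} \<Longrightarrow> proper_fun (h i) \<and> closed_fun (h i) \<and> convex_fun (h i)"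
    and quadratic: "j \<in> {r+1..r+m} \<Longrightarrow> h j = (\<lambda>x. ereal (1 / 2 * (norm (x - x0))\<^sup>2))"
    and alg: "algorithm_A (r + m) h (\<lambda>x. (real m + 1) / 2 * (norm (x - x0))\<^sup>2)
        (1 / (real m + 1)) wbar S z"
    and proc: "procedure_I r m h wbar S S' z"
    and ABC: "condition_ABC r m wbar S S'"
begin

abbreviation \<phi> :: "nat \<Rightarrow> 'a \<Rightarrow> ereal" where
  "\<phi> i \<equiv> fenchel_conj (h i)"

definition v :: "nat \<Rightarrow> nat \<Rightarrow> 'a" where
  "v n w = (\<Sum>i=1..r+m. z n w i)"

definition active :: "nat \<Rightarrow> nat \<Rightarrow> nat set" where
  "active n w = {j. j \<in> {r+1..r+m} \<and> S' n w j \<noteq> {}}"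

text \<open>
  The starting point is arbitrary, so conjugates may be infinite during the first cycle. Only where
  this predicate holds does the dual objective have the real value \<open>dual_value\<close>.
\<close>

definition finite_at :: "nat \<Rightarrow> nat \<Rightarrow> bool" where
  "finite_at n w \<longleftrightarrow> (\<forall>i\<in>{1..r+m}. \<bar>\<phi> i (z n w i)\<bar> \<noteq> \<infinity>)"

definition dual_value :: "nat \<Rightarrow> nat \<Rightarrow> real" where
  "dual_value n w = - (\<Sum>i=1..r+m. real_of_ereal (\<phi> i (z n w i)))
     - (norm (x0 - v n w))\<^sup>2 / 2 + (norm x0)\<^sup>2 / 2"

definition increment :: "nat \<Rightarrow> real" where
  "increment n = (\<Sum>w=1..wbar. norm (v n w - v n (w - 1))
     + (\<Sum>j\<in>active n w. norm (z n w j - z n (w - 1) j)))"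

definition increment_sq :: "nat \<Rightarrow> real" where
  "increment_sq n = (\<Sum>w=1..wbar. (norm (v n w - v n (w - 1)))\<^sup>2
     + (\<Sum>j\<in>active n w. (norm (z n w j - z n (w - 1) j))\<^sup>2))"

lemma finite_active [simp]: "finite (active n w)"
  by (simp add: active_def)

lemma proper_closed_convex:
  assumes "i \<in> {1..r+m}"
  shows "proper_fun (h i)" "closed_fun (h i)" "convex_fun (h i)"
proof -
  have "proper_fun (\<lambda>x. ereal (1 / 2 * (norm (x - x0))\<^sup>2))"
    by (simp add: proper_fun_def)
  moreover note closed_fun_quadratic[of x0] convex_fun_quadratic[of x0]
  moreover have "i \<in> {1..r} \<or> i \<in> {r+1..r+m}" using assms by auto
  ultimately have "proper_fun (h i) \<and> closed_fun (h i) \<and> convex_fun (h i)"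
    using closed_convex[of i] quadratic[of i] by auto
  then show "proper_fun (h i)" "closed_fun (h i)" "convex_fun (h i)" by auto
qed

lemma h_not_MInf: "i \<in> {1..r+m} \<Longrightarrow> h i u \<noteq> -\<infinity>"
  using proper_closed_convex(1) by (auto simp: proper_fun_def)

lemma proper_conj: "i \<in> {1..r+m} \<Longrightarrow> proper_fun (\<phi> i)"
  by (intro proper_fun_fenchel_conj proper_closed_convex)

lemma conj_not_MInf: "i \<in> {1..r+m} \<Longrightarrow> \<phi> i y \<noteq> -\<infinity>"
  using proper_conj by (auto simp: proper_fun_def)

lemma convex_conj: "i \<in> {1..r+m} \<Longrightarrow> convex_fun (\<phi> i)"
  by (intro convex_fun_fenchel_conj h_not_MInf)

lemma conj_quadratic: "j \<in> {r+1..r+m} \<Longrightarrow> \<phi> j y = ereal (y \<bullet> x0 + (norm y)\<^sup>2 / 2)"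
  using fenchel_conj_quadratic[of 1 x0 y] quadratic[of j] by simp

text \<open>
  The exact expansion shows at once that \<open>x0 + a\<close> is the gradient at \<open>a\<close> and that the conjugate is strongly
  convex with modulus one.
\<close>

lemma conj_quadratic_add:
  assumes "j \<in> {r+1..r+m}"
  shows "\<phi> j (a + d) = \<phi> j a + ereal ((x0 + a) \<bullet> d + (norm d)\<^sup>2 / 2)"
  using half_norm_sq_add[of a d]
  by (simp add: conj_quadratic[OF assms] inner_add_left inner_add_right inner_commute)

text \<open>
  The coupling term of the dual objective in closed form; up to a constant it is half of the squared
  norm of the primal point attached to \<open>y\<close>.
\<close>

lemma penalty_eq:
  "ereal (1 / (real m + 1)) * fenchel_conj (\<lambda>x. ereal ((real m + 1) / 2 * (norm (x - x0))\<^sup>2))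
     (- (1 / (1 / (real m + 1))) *\<^sub>R y) = ereal ((norm (x0 - y))\<^sup>2 / 2 - (norm x0)\<^sup>2 / 2)"
proof -
  define c where "c = real m + 1"
  have c: "c > 0" by (simp add: c_def)
  have "ereal (1 / c) * fenchel_conj (\<lambda>x. ereal (c / 2 * (norm (x - x0))\<^sup>2)) (- (1 / (1 / c)) *\<^sub>R y)
      = ereal (- (y \<bullet> x0) + (norm y)\<^sup>2 / 2)"
    using c by (subst fenchel_conj_quadratic) (auto simp: field_simps power2_eq_square)
  also have "- (y \<bullet> x0) + (norm y)\<^sup>2 / 2 = (norm (x0 - y))\<^sup>2 / 2 - (norm x0)\<^sup>2 / 2"
    by (simp add: half_norm_sq_diff inner_commute)
  finally show ?thesis unfolding c_def .
qed

context
  fixes n w :: nat assumes n: "n \<ge> 1" and w: "w \<in> {1..wbar}"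
begin

lemma S_subset: "S n w \<subseteq> {1..r+m}"
  and rest_sum: "(\<Sum>i\<in>{1..r+m} - S n w. z n w i) = (\<Sum>i\<in>{1..r+m} - S n w. z n (w - 1) i)"
  and step_a: "is_arg_min (step_a_objective (r + m) h (\<lambda>x. (real m + 1) / 2 * (norm (x - x0))\<^sup>2)
      (1 / (real m + 1)) (S n w) (z n (w - 1))) (\<lambda>_. True) (z n w)"
  using alg[unfolded algorithm_A_def, rule_format, OF n, THEN conjunct1, rule_format, OF w]
  by simp_all

lemma S'_disjoint: "disjoint_family_on (S' n w) {r+1..r+m}"
  and S_S'_disjoint: "S n w \<inter> (\<Union>j\<in>{r+1..r+m}. S' n w j) = {}"
  and S'_block: "\<forall>j\<in>{r+1..r+m}. S' n w j \<subseteq> {1..r} \<union> {j} \<and> (S' n w j \<noteq> {} \<longrightarrow> {j} \<subset> S' n w j) \<and>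
      is_arg_min (\<lambda>y. \<Sum>i\<in>S' n w j. \<phi> i (y i))
        (\<lambda>y. (\<Sum>i\<in>S' n w j. y i) = (\<Sum>i\<in>S' n w j. z n (w - 1) i)) (z n w)"
  and unchanged: "\<forall>i\<in>{1..r+m}. i \<notin> S n w \<union> (\<Union>j\<in>{r+1..r+m}. S' n w j) \<longrightarrow> z n w i = z n (w - 1) i"
proof -
  note all = proc[unfolded procedure_I_def, THEN spec, THEN mp, OF n, THEN bspec, OF w]
  show "disjoint_family_on (S' n w) {r+1..r+m}" using all by (elim conjE)
  show "S n w \<inter> (\<Union>j\<in>{r+1..r+m}. S' n w j) = {}" using all by (elim conjE)
  show "\<forall>j\<in>{r+1..r+m}. S' n w j \<subseteq> {1..r} \<union> {j} \<and> (S' n w j \<noteq> {} \<longrightarrow> {j} \<subset> S' n w j) \<and>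
      is_arg_min (\<lambda>y. \<Sum>i\<in>S' n w j. \<phi> i (y i))
        (\<lambda>y. (\<Sum>i\<in>S' n w j. y i) = (\<Sum>i\<in>S' n w j. z n (w - 1) i)) (z n w)"
    using all by (elim conjE)
  show "\<forall>i\<in>{1..r+m}. i \<notin> S n w \<union> (\<Union>j\<in>{r+1..r+m}. S' n w j) \<longrightarrow> z n w i = z n (w - 1) i"
    using all by (elim conjE)
qed

lemma untouched:
  assumes "i \<in> {1..r+m}" "i \<notin> S n w" "\<And>j. j \<in> {r+1..r+m} \<Longrightarrow> i \<notin> S' n w j"
  shows "z n w i = z n (w - 1) i"
  using bspec[OF unchanged assms(1)] assms(2,3) by blast

lemma S'_props:
  assumes "j \<in> {r+1..r+m}"
  shows "S' n w j \<subseteq> {1..r} \<union> {j}"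
    and "S' n w j \<noteq> {} \<Longrightarrow> j \<in> S' n w j"
    and "S' n w j \<subseteq> {1..r+m}" "finite (S' n w j)"
    and "is_arg_min (\<lambda>y. \<Sum>i\<in>S' n w j. \<phi> i (y i))
             (\<lambda>y. (\<Sum>i\<in>S' n w j. y i) = (\<Sum>i\<in>S' n w j. z n (w - 1) i)) (z n w)"
proof -
  note all = bspec[OF S'_block assms]
  show 1: "S' n w j \<subseteq> {1..r} \<union> {j}" using all by (elim conjE)
  show "j \<in> S' n w j" if "S' n w j \<noteq> {}" using all that by blast
  show "is_arg_min (\<lambda>y. \<Sum>i\<in>S' n w j. \<phi> i (y i))
             (\<lambda>y. (\<Sum>i\<in>S' n w j. y i) = (\<Sum>i\<in>S' n w j. z n (w - 1) i)) (z n w)"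
    using all by (elim conjE)
  show "S' n w j \<subseteq> {1..r+m}" using 1 assms by auto
  then show "finite (S' n w j)" by (rule finite_subset) simp
qed

lemma sum_split: "(\<Sum>i=1..r+m. f i) = (\<Sum>i\<in>S n w. f i) + (\<Sum>i\<in>{1..r+m} - S n w. f i)"
  for f :: "nat \<Rightarrow> 'b::comm_monoid_add"
  using sum.subset_diff[OF S_subset, of f] by (simp add: add.commute)

lemma v_split: "v n w = (\<Sum>i\<in>S n w. z n w i) + (\<Sum>i\<in>{1..r+m} - S n w. z n (w - 1) i)"
  unfolding v_def rest_sum[symmetric] by (rule sum_split)

text \<open>
  Minimality is tested by moving the component \<open>i\<close> alone. The coupling term then changes by a quadratic
  with linear part \<open>- (x0 - v n w) \<bullet> d\<close>.
\<close>

lemma subgradient_on_S: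
  assumes i: "i \<in> S n w"
  shows "x0 - v n w \<in> subdifferential (\<phi> i) (z n w i)"
proof -
  let ?T = "S n w" and ?y = "z n w"
  let ?c = "\<Sum>i\<in>{1..r+m} - S n w. z n (w - 1) i"
  let ?q = "\<lambda>Y :: nat \<Rightarrow> 'a. (norm (x0 - ((\<Sum>i\<in>?T. Y i) + ?c)))\<^sup>2 / 2 - (norm x0)\<^sup>2 / 2"
  have finT: "finite ?T" using S_subset by (rule finite_subset) simp
  have iN: "i \<in> {1..r+m}" using i S_subset by auto
  have min: "(\<Sum>k\<in>?T. \<phi> k (?y k)) + ereal (?q ?y) \<le> (\<Sum>k\<in>?T. \<phi> k (Y k)) + ereal (?q Y)" for Y
    using step_a unfolding is_arg_min_def step_a_objective_def penalty_eq by (simp add: not_less)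
  have "\<forall>k\<in>{1..r+m}. \<exists>y. \<phi> k y \<noteq> \<infinity>" using proper_conj by (auto simp: proper_fun_def)
  then obtain Y where "\<forall>k\<in>{1..r+m}. \<phi> k (Y k) \<noteq> \<infinity>" by metis
  then have "(\<Sum>k\<in>?T. \<phi> k (Y k)) \<noteq> \<infinity>" using S_subset by (auto simp: sum_Pinfty)
  with min[of Y] have "(\<Sum>k\<in>?T. \<phi> k (?y k)) \<noteq> \<infinity>" by auto
  then have "\<forall>k\<in>?T. \<phi> k (?y k) \<noteq> \<infinity>" using finT by (auto simp: sum_Pinfty)
  then have fin: "\<bar>\<phi> k (?y k)\<bar> \<noteq> \<infinity>" if "k \<in> ?T" for k
    using that S_subset conj_not_MInf[of k "?y k"] by auto
  have "\<bar>\<Sum>k\<in>?T - {i}. \<phi> k (?y k)\<bar> \<noteq> \<infinity>" using fin by (auto simp: sum_Inf)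
  then obtain R where R: "(\<Sum>k\<in>?T - {i}. \<phi> k (?y k)) = ereal R" by auto
  obtain a where a: "\<phi> i (?y i) = ereal a" using fin[OF i] by auto
  have v: "(\<Sum>k\<in>?T. ?y k) + ?c = v n w" using v_split by simp
  show ?thesis
  proof (rule subgradient_of_quadratic_minorant)
    show "convex_fun (\<phi> i)" using iN by (rule convex_conj)
    show "\<bar>\<phi> i (z n w i)\<bar> \<noteq> \<infinity>" using i by (rule fin)
    fix d
    define Y where "Y = ?y(i := ?y i + d)"
    have "(\<Sum>k\<in>?T. Y k) = ?y i + d + (\<Sum>k\<in>?T - {i}. ?y k)"
      unfolding sum.remove[OF finT i, of Y] by (simp add: Y_def)
    also have "\<dots> = (\<Sum>k\<in>?T. ?y k) + d" using sum.remove[OF finT i, of ?y] by simp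
    finally have Y: "x0 - ((\<Sum>k\<in>?T. Y k) + ?c) = (x0 - v n w) - d"
      unfolding v[symmetric] by (simp add: algebra_simps)
    have q: "?q Y = ?q ?y + ((norm d)\<^sup>2 / 2 - (x0 - v n w) \<bullet> d)"
      unfolding v Y using half_norm_sq_diff[of "x0 - v n w" d] by simp
    have "(\<Sum>k\<in>?T. \<phi> k (Y k)) = \<phi> i (?y i + d) + ereal R"
      unfolding sum.remove[OF finT i] R[symmetric] by (simp add: Y_def)
    moreover have "(\<Sum>k\<in>?T. \<phi> k (?y k)) = ereal a + ereal R"
      unfolding sum.remove[OF finT i] R a ..
    ultimately have "ereal a + ereal R + ereal (?q ?y)
        \<le> \<phi> i (?y i + d) + ereal R + ereal (?q ?y + ((norm d)\<^sup>2 / 2 - (x0 - v n w) \<bullet> d))"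
      using min[of Y] unfolding q by simp
    then show "\<phi> i (?y i) \<le> \<phi> i (?y i + d) + ereal ((norm d)\<^sup>2 / 2 - (x0 - v n w) \<bullet> d)"
      using conj_not_MInf[OF iN, of "?y i + d"] by (cases "\<phi> i (?y i + d)") (auto simp: a)
  qed
qed

text \<open>
  The constraint fixes the sum over the block, so moving \<open>i\<close> by \<open>d\<close> is compensated by moving \<open>j\<close> by \<open>- d\<close>, and the
  quadratic conjugate of \<open>h j\<close> takes over the role of the coupling term: the Lagrange multiplier of
  the constraint is its gradient.
\<close>

lemma subgradient_on_S':
  assumes j: "j \<in> {r+1..r+m}" and i: "i \<in> S' n w j"
  shows "x0 + z n w j \<in> subdifferential (\<phi> i) (z n w i)"
proof (cases "i = j")
  case True
  have "\<phi> j (z n w j) + ereal ((x0 + z n w j) \<bullet> (y - z n w j)) \<le> \<phi> j y" for y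
    using conj_quadratic_add[OF j, of "z n w j" "y - z n w j"] by (simp add: conj_quadratic[OF j])
  then show ?thesis by (simp add: True subdifferential_def conj_quadratic[OF j])
next
  case False
  let ?T = "S' n w j" and ?y = "z n w"
  have jT: "j \<in> ?T" using S'_props(2)[OF j] i by auto
  have finT: "finite ?T" using S'_props(4)[OF j] .
  have iN: "i \<in> {1..r+m}" using i S'_props(3)[OF j] by auto
  have jT': "j \<in> ?T - {i}" using jT False by auto
  have finT': "finite (?T - {i})" using finT by simp
  have feas: "(\<Sum>i\<in>?T. ?y i) = (\<Sum>i\<in>?T. z n (w - 1) i)"
    using S'_props(5)[OF j] by (simp add: is_arg_min_def)
  have min: "(\<Sum>k\<in>?T. \<phi> k (?y k)) \<le> (\<Sum>k\<in>?T. \<phi> k (Y k))" if "(\<Sum>i\<in>?T. Y i) = (\<Sum>i\<in>?T. ?y i)" for Y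
    using S'_props(5)[OF j] that feas by (auto simp: is_arg_min_def not_less)
  have split: "(\<Sum>k\<in>?T. f k) = f i + (f j + (\<Sum>k\<in>?T - {i} - {j}. f k))"
    for f :: "nat \<Rightarrow> 'b::comm_monoid_add"
    using sum.remove[OF finT i, of f] sum.remove[OF finT' jT', of f] by simp
  \<comment> \<open>The coordinate \<open>j\<close> has a finite conjugate everywhere, so it can absorb any defect.\<close>
  have "\<forall>k\<in>{1..r+m}. \<exists>y. \<phi> k y \<noteq> \<infinity>" using proper_conj by (auto simp: proper_fun_def)
  then obtain Y where Y: "\<forall>k\<in>{1..r+m}. \<phi> k (Y k) \<noteq> \<infinity>" by metis
  define Y' where "Y' = Y(j := (\<Sum>i\<in>?T. ?y i) - (\<Sum>k\<in>?T - {j}. Y k))"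
  have "(\<Sum>k\<in>?T. Y' k) = (\<Sum>i\<in>?T. ?y i)"
    unfolding sum.remove[OF finT jT, of Y'] by (simp add: Y'_def)
  note min[OF this]
  moreover have "\<phi> k (Y' k) \<noteq> \<infinity>" if "k \<in> ?T" for k
    using Y that S'_props(3)[OF j] by (auto simp: Y'_def conj_quadratic[OF j])
  then have "(\<Sum>k\<in>?T. \<phi> k (Y' k)) \<noteq> \<infinity>" by (auto simp: sum_Pinfty)
  ultimately have "(\<Sum>k\<in>?T. \<phi> k (?y k)) \<noteq> \<infinity>" by auto
  then have "\<forall>k\<in>?T. \<phi> k (?y k) \<noteq> \<infinity>" using finT by (auto simp: sum_Pinfty)
  then have fin: "\<bar>\<phi> k (?y k)\<bar> \<noteq> \<infinity>" if "k \<in> ?T" for k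
    using that S'_props(3)[OF j] conj_not_MInf[of k "?y k"] by auto
  have "\<bar>\<Sum>k\<in>?T - {i} - {j}. \<phi> k (?y k)\<bar> \<noteq> \<infinity>" using fin by (auto simp: sum_Inf)
  then obtain R where R: "(\<Sum>k\<in>?T - {i} - {j}. \<phi> k (?y k)) = ereal R" by auto
  obtain a where a: "\<phi> i (?y i) = ereal a" using fin[OF i] by auto
  show ?thesis
  proof (rule subgradient_of_quadratic_minorant)
    show "convex_fun (\<phi> i)" using iN by (rule convex_conj)
    show "\<bar>\<phi> i (z n w i)\<bar> \<noteq> \<infinity>" using i by (rule fin)
    fix d
    define Y where "Y = ?y(i := ?y i + d, j := ?y j - d)"
    have rest: "(\<Sum>k\<in>?T - {i} - {j}. f k (Y k)) = (\<Sum>k\<in>?T - {i} - {j}. f k (?y k))"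
      for f :: "nat \<Rightarrow> 'a \<Rightarrow> 'b::comm_monoid_add"
      by (rule sum.cong) (auto simp: Y_def)
    have Yij: "Y i = ?y i + d" "Y j = ?y j - d" using False by (auto simp: Y_def)
    have "(\<Sum>k\<in>?T. Y k) = (\<Sum>k\<in>?T. ?y k)"
      unfolding split rest[of "\<lambda>_ u. u"] Yij by simp
    from min[OF this]
    have "ereal a + (\<phi> j (?y j) + ereal R) \<le> \<phi> i (?y i + d) + (\<phi> j (?y j - d) + ereal R)"
      unfolding split rest[of "\<lambda>k u. \<phi> k u"] Yij R a .
    moreover have "\<phi> j (?y j - d) = \<phi> j (?y j) + ereal ((norm d)\<^sup>2 / 2 - (x0 + ?y j) \<bullet> d)"
      using conj_quadratic_add[OF j, of "?y j" "- d"] by simp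
    ultimately show "\<phi> i (?y i) \<le> \<phi> i (?y i + d) + ereal ((norm d)\<^sup>2 / 2 - (x0 + ?y j) \<bullet> d)"
      using conj_not_MInf[OF iN, of "?y i + d"]
      by (cases "\<phi> i (?y i + d)") (auto simp: a conj_quadratic[OF j])
  qed
qed

text \<open>
  Subgradients exist only where the function is finite, so every component updated in the step has a finite
  conjugate afterwards; the others are carried over.
\<close>

lemma finite_at_step:
  assumes "finite_at n (w - 1)"
  shows "finite_at n w"
  unfolding finite_at_def
proof
  fix i assume i: "i \<in> {1..r+m}"
  show "\<bar>\<phi> i (z n w i)\<bar> \<noteq> \<infinity>"
  proof (cases "i \<in> S n w \<or> (\<exists>j\<in>{r+1..r+m}. i \<in> S' n w j)")
    case True
    then show ?thesis
    proof
      assume "i \<in> S n w"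
      from subgradient_on_S[OF this] show ?thesis by (simp add: subdifferential_def)
    next
      assume "\<exists>j\<in>{r+1..r+m}. i \<in> S' n w j"
      then obtain j where "j \<in> {r+1..r+m}" "i \<in> S' n w j" by blast
      from subgradient_on_S'[OF this] show ?thesis by (simp add: subdifferential_def)
    qed
  next
    case False
    then show ?thesis using untouched[OF i] assms i by (auto simp: finite_at_def)
  qed
qed

text \<open>
  The subgradient inequalities are added over \<open>S n w\<close> and over each block of Procedure I. The linear terms
  combine with the change of \<open>v\<close> and cancel, in the second case because the block sum is kept, and the
  second order remainders of the two kinds of quadratics are the gain.
\<close>

lemma dual_value_step:
  assumes fin0: "finite_at n (w - 1)"
  shows "dual_value n (w - 1) + (norm (v n w - v n (w - 1)))\<^sup>2 / 2
      + (\<Sum>j\<in>active n w. (norm (z n w j - z n (w - 1) j))\<^sup>2) / 2 \<le> dual_value n w"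
proof -
  have fin1: "finite_at n w" using fin0 by (rule finite_at_step)
  let ?N = "{1..r+m}"
  define \<Delta> where "\<Delta> i = z n (w - 1) i - z n w i" for i
  define e where "e i = real_of_ereal (\<phi> i (z n (w - 1) i)) - real_of_ereal (\<phi> i (z n w i))" for i
  have e_ge: "s \<bullet> \<Delta> i \<le> e i" if "i \<in> ?N" and s: "s \<in> subdifferential (\<phi> i) (z n w i)" for i s
  proof -
    have real: "ereal (real_of_ereal (\<phi> i (z n w i))) = \<phi> i (z n w i)"
        "ereal (real_of_ereal (\<phi> i (z n (w - 1) i))) = \<phi> i (z n (w - 1) i)"
      using bspec[OF fin0[unfolded finite_at_def] that(1)] bspec[OF fin1[unfolded finite_at_def] that(1)]
      by (simp_all only: ereal_real' simp_thms)
    have "\<phi> i (z n w i) + ereal (s \<bullet> \<Delta> i) \<le> \<phi> i (z n (w - 1) i)"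
      using s unfolding subdifferential_def \<Delta>_def by blast
    then have "ereal (real_of_ereal (\<phi> i (z n w i)) + s \<bullet> \<Delta> i) \<le> ereal (real_of_ereal (\<phi> i (z n (w - 1) i)))"
      unfolding plus_ereal.simps(1)[symmetric] real .
    then show ?thesis by (simp add: e_def)
  qed
  have S_part: "(x0 - v n w) \<bullet> (v n (w - 1) - v n w) \<le> (\<Sum>i\<in>S n w. e i)"
  proof -
    have "v n (w - 1) = (\<Sum>i\<in>S n w. z n (w - 1) i) + (\<Sum>i\<in>?N - S n w. z n (w - 1) i)"
      unfolding v_def by (rule sum_split)
    with v_split have "v n (w - 1) - v n w = (\<Sum>i\<in>S n w. z n (w - 1) i) - (\<Sum>i\<in>S n w. z n w i)"
      by (simp only: add_diff_cancel_right)
    also have "\<dots> = (\<Sum>i\<in>S n w. \<Delta> i)"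
      unfolding \<Delta>_def by (rule sum_subtractf[symmetric])
    finally have "v n (w - 1) - v n w = (\<Sum>i\<in>S n w. \<Delta> i)" .
    then have "(x0 - v n w) \<bullet> (v n (w - 1) - v n w) = (\<Sum>i\<in>S n w. (x0 - v n w) \<bullet> \<Delta> i)"
      by (simp only: inner_sum_right)
    also have "\<dots> \<le> (\<Sum>i\<in>S n w. e i)"
      by (rule sum_mono) (use S_subset in \<open>blast intro: e_ge subgradient_on_S\<close>)
    finally show ?thesis .
  qed
  have S'_part: "(norm (\<Delta> j))\<^sup>2 / 2 \<le> (\<Sum>i\<in>S' n w j. e i)" if "j \<in> active n w" for j
  proof -
    have j: "j \<in> {r+1..r+m}" and jT: "j \<in> S' n w j"
      using that S'_props(2)[of j] by (auto simp: active_def)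
    let ?T = "S' n w j"
    note finT = S'_props(4)[OF j]
    have "(\<Sum>i\<in>?T. z n w i) = (\<Sum>i\<in>?T. z n (w - 1) i)"
      using S'_props(5)[OF j] by (simp add: is_arg_min_def)
    then have "(\<Sum>i\<in>?T. \<Delta> i) = 0" by (simp add: \<Delta>_def sum_subtractf)
    then have "0 = (\<Sum>i\<in>?T. (x0 + z n w j) \<bullet> \<Delta> i)" by (simp flip: inner_sum_right)
    also have "\<dots> = (x0 + z n w j) \<bullet> \<Delta> j + (\<Sum>i\<in>?T - {j}. (x0 + z n w j) \<bullet> \<Delta> i)"
      by (rule sum.remove[OF finT jT])
    also have "(\<Sum>i\<in>?T - {j}. (x0 + z n w j) \<bullet> \<Delta> i) \<le> (\<Sum>i\<in>?T - {j}. e i)"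
      by (rule sum_mono) (use S'_props(3)[OF j] in \<open>blast intro: e_ge subgradient_on_S'[OF j]\<close>)
    also have "(x0 + z n w j) \<bullet> \<Delta> j = e j - (norm (\<Delta> j))\<^sup>2 / 2"
      using conj_quadratic_add[OF j, of "z n w j" "\<Delta> j"] by (simp add: e_def conj_quadratic[OF j] \<Delta>_def)
    finally show ?thesis using sum.remove[OF finT jT, of e] by simp
  qed
  have "(\<Sum>j\<in>active n w. (norm (\<Delta> j))\<^sup>2) / 2 \<le> (\<Sum>i\<in>?N - S n w. e i)"
  proof -
    let ?U = "\<Union>j\<in>{r+1..r+m}. S' n w j"
    have U: "?U \<subseteq> ?N - S n w" using S'_props(3) S_S'_disjoint by blast
    have "(\<Sum>j\<in>active n w. (norm (\<Delta> j))\<^sup>2) / 2 = (\<Sum>j\<in>active n w. (norm (\<Delta> j))\<^sup>2 / 2)"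
      by (simp add: sum_divide_distrib)
    also have "\<dots> \<le> (\<Sum>j\<in>active n w. \<Sum>i\<in>S' n w j. e i)"
      by (intro sum_mono S'_part)
    also have "\<dots> = (\<Sum>j\<in>{r+1..r+m}. \<Sum>i\<in>S' n w j. e i)"
      by (intro sum.mono_neutral_left) (auto simp: active_def)
    also have "\<dots> = (\<Sum>i\<in>?U. e i)"
      using S'_props(4) S'_disjoint
      by (intro sum.UNION_disjoint[symmetric]) (auto simp: disjoint_family_on_def)
    also have "\<dots> = (\<Sum>i\<in>?N - S n w. e i)"
      using U untouched by (intro sum.mono_neutral_left) (auto simp: e_def)
    finally show ?thesis .
  qed
  with S_part have "(x0 - v n w) \<bullet> (v n (w - 1) - v n w) + (\<Sum>j\<in>active n w. (norm (\<Delta> j))\<^sup>2) / 2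
      \<le> (\<Sum>i\<in>S n w. e i) + (\<Sum>i\<in>?N - S n w. e i)"
    by simp
  also have "\<dots> = (\<Sum>i\<in>?N. e i)" by (rule sum_split[symmetric])
  also have "\<dots> = dual_value n w + (norm (x0 - v n w))\<^sup>2 / 2
      - (dual_value n (w - 1) + (norm (x0 - v n (w - 1)))\<^sup>2 / 2)"
    by (simp add: dual_value_def e_def sum_subtractf)
  also have "(norm (x0 - v n (w - 1)))\<^sup>2 / 2 = (norm (x0 - v n w))\<^sup>2 / 2
      - (x0 - v n w) \<bullet> (v n (w - 1) - v n w) + (norm (v n w - v n (w - 1)))\<^sup>2 / 2"
    using half_norm_sq_diff[of "x0 - v n w" "v n (w - 1) - v n w"] by (simp add: norm_minus_commute)
  finally show ?thesis by (simp add: \<Delta>_def norm_minus_commute)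
qed

end

end

section \<open>Subgradients and dual values over a full cycle\<close>

context dykstra_splitting
begin

text \<open>
  The component \<open>i\<close> keeps the value it got in its last update, at \<open>p\<close>. If that update was of type (a), its
  subgradient is \<open>x0 - v n p\<close>. If it happened in the block of \<open>j\<close>, the subgradient is \<open>x0 + z n p j\<close>; the index
  condition provides an earlier step \<open>q\<close> of type (a) on \<open>j\<close>, after which \<open>z n q j = - v n q\<close>, and this component
  then stays put until \<open>p\<close>. Either way the distance to \<open>x0 - v n wbar\<close> is paid for by increments of
  the cycle.
\<close>

lemma subgradient_near:
  assumes n: "n \<ge> 1" and i: "i \<in> {1..r+m}"
  shows "\<exists>\<xi>\<in>subdifferential (\<phi> i) (z n wbar i). norm (\<xi> - (x0 - v n wbar)) \<le> increment n"
proof -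
  obtain p where p: "p \<in> {1..wbar}" and A: "condition_A r m wbar S S' n i p"
      and B: "condition_B r m S S' n i p"
    using ABC n i unfolding condition_ABC_def by meson
  let ?dv = "\<lambda>w. norm (v n w - v n (w - 1))"
  let ?dz = "\<lambda>w. \<Sum>j\<in>active n w. norm (z n w j - z n (w - 1) j)"
  have "norm (z n wbar i - z n p i) \<le> (\<Sum>w=p+1..wbar. norm (z n w i - z n (w - 1) i))"
    using p by (intro norm_diff_le_sum_increments[of p wbar "\<lambda>w. z n w i"]) auto
  also have "\<dots> = 0"
  proof (rule sum.neutral, rule ballI)
    fix w assume w: "w \<in> {p+1..wbar}"
    then have "z n w i = z n (w - 1) i"
      using A i n by (intro untouched) (auto simp: condition_A_def)
    then show "norm (z n w i - z n (w - 1) i) = 0" by simp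
  qed
  finally have same: "z n wbar i = z n p i" by simp
  from A consider "i \<in> S n p" | j where "j \<in> {r+1..r+m}" "i \<in> S' n p j"
    unfolding condition_A_def by blast
  then show ?thesis
  proof cases
    case 1
    have "x0 - v n p \<in> subdifferential (\<phi> i) (z n wbar i)"
      unfolding same using n p 1 by (rule subgradient_on_S)
    moreover have "norm ((x0 - v n p) - (x0 - v n wbar)) \<le> increment n"
    proof -
      have "norm ((x0 - v n p) - (x0 - v n wbar)) = norm (v n wbar - v n p)" by simp
      also have "\<dots> \<le> (\<Sum>w=p+1..wbar. ?dv w)" using p by (intro norm_diff_le_sum_increments) simp
      also have "\<dots> \<le> (\<Sum>w=1..wbar. ?dv w)" by (rule sum_mono2) auto
      also have "\<dots> \<le> increment n"
        unfolding increment_def by (intro sum_mono) (simp add: sum_nonneg)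
      finally show ?thesis .
    qed
    ultimately show ?thesis by blast
  next
    case 2
    obtain q where q: "q \<in> {1..p-1}" "j \<in> S n q"
      and quiet: "\<forall>w\<in>{q+1..p-1}. S' n p j \<inter> S n w = {} \<and> (\<forall>j'\<in>{r+1..r+m}. S' n p j \<inter> S' n w j' = {})"
      using bspec[OF B[unfolded condition_B_def] 2(1)] 2(2) by blast
    have jact: "j \<in> active n p" using 2 by (auto simp: active_def)
    have jT: "j \<in> S' n p j" using S'_props(2)[OF n p 2(1)] 2(2) by blast
    have jN: "j \<in> {1..r+m}" using 2(1) by auto
    have qw: "q \<in> {1..wbar}" using p q by auto
    \<comment> \<open>The conjugate of \<open>h j\<close> is differentiable with gradient \<open>x0 + z\<close>, which pins the
      component down when \<open>j\<close> is treated in a step of the first kind.\<close>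
    have "z n q j = - v n q"
    proof -
      have "\<phi> j (z n q j) + ereal ((x0 - v n q) \<bullet> d) \<le> \<phi> j (z n q j + d)" for d
        using subgradient_on_S[OF n qw q(2)] unfolding subdifferential_def
        by (auto dest: spec[of _ "z n q j + d"])
      then have "(x0 - v n q) \<bullet> d \<le> (x0 + z n q j) \<bullet> d + (norm d)\<^sup>2 / 2" for d
        unfolding conj_quadratic_add[OF 2(1)] by (simp add: conj_quadratic[OF 2(1)])
      note le = this
      define u where "u = v n q + z n q j"
      have "x0 + z n q j = (x0 - v n q) + u" by (simp add: u_def)
      then have "(x0 - v n q) \<bullet> (- u) \<le> ((x0 - v n q) + u) \<bullet> (- u) + (norm (- u))\<^sup>2 / 2"
        using le[of "- u"] by (simp only:)
      then have "u \<bullet> u \<le> (norm u)\<^sup>2 / 2"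
        unfolding inner_add_left by simp
      then have "norm u = 0" by (simp add: power2_norm_eq_inner[symmetric])
      then show ?thesis by (simp add: u_def add_eq_0_iff)
    qed
    have "norm (z n (p - 1) j - z n q j) \<le> (\<Sum>w=q+1..p-1. norm (z n w j - z n (w - 1) j))"
      using q by (intro norm_diff_le_sum_increments[of q "p - 1" "\<lambda>w. z n w j"]) auto
    also have "\<dots> = 0"
    proof (rule sum.neutral, rule ballI)
      fix w assume w: "w \<in> {q+1..p-1}"
      have "z n w j = z n (w - 1) j"
        using n _ jN
      proof (rule untouched)
        show "w \<in> {1..wbar}" using w p by auto
        show "j \<notin> S n w" using bspec[OF quiet w] jT by blast
        show "j \<notin> S' n w j'" if "j' \<in> {r+1..r+m}" for j' using bspec[OF quiet w] jT that by blast
      qed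
      then show "norm (z n w j - z n (w - 1) j) = 0" by simp
    qed
    finally have zp: "z n (p - 1) j = - v n q" using \<open>z n q j = - v n q\<close> by (simp add: eq_neg_iff_add_eq_0)
    have "x0 + z n p j \<in> subdifferential (\<phi> i) (z n wbar i)"
      unfolding same using n p 2 by (rule subgradient_on_S')
    moreover have "norm ((x0 + z n p j) - (x0 - v n wbar)) \<le> increment n"
    proof -
      have "(x0 + z n p j) - (x0 - v n wbar) = (v n wbar - v n q) + (z n p j - z n (p - 1) j)"
        using zp by simp
      then have "norm ((x0 + z n p j) - (x0 - v n wbar))
          \<le> norm (v n wbar - v n q) + norm (z n p j - z n (p - 1) j)"
        by (simp only: norm_triangle_ineq)
      also have "norm (v n wbar - v n q) \<le> (\<Sum>w=q+1..wbar. ?dv w)"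
        using qw by (intro norm_diff_le_sum_increments) simp
      also have "\<dots> \<le> (\<Sum>w=1..wbar. ?dv w)" by (rule sum_mono2) auto
      also have "norm (z n p j - z n (p - 1) j) \<le> ?dz p"
        using member_le_sum[OF jact, of "\<lambda>j. norm (z n p j - z n (p - 1) j)"] by simp
      also have "\<dots> \<le> (\<Sum>w=1..wbar. ?dz w)"
        using member_le_sum[OF p, of ?dz] by (simp add: sum_nonneg)
      also have "(\<Sum>w=1..wbar. ?dv w) + (\<Sum>w=1..wbar. ?dz w) = increment n"
        by (simp add: increment_def sum.distrib)
      finally show ?thesis by simp
    qed
    ultimately show ?thesis by blast
  qed
qed

text \<open>
  Since every index is updated at least once in a cycle, all conjugates are finite at its end, even if they
  were not at the starting point.
\<close>

lemma finite_at_end: "n \<ge> 1 \<Longrightarrow> finite_at n wbar"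
  unfolding finite_at_def using subgradient_near by (fastforce simp: subdifferential_def)

lemma restart: "n \<ge> 1 \<Longrightarrow> i \<in> {1..r+m} \<Longrightarrow> z (Suc n) 0 i = z n wbar i"
  using alg unfolding algorithm_A_def by simp

lemma restart_eq:
  assumes "n \<ge> 1"
  shows "v (Suc n) 0 = v n wbar" "dual_value (Suc n) 0 = dual_value n wbar" "finite_at (Suc n) 0"
proof -
  show v: "v (Suc n) 0 = v n wbar"
    unfolding v_def using restart[OF assms] by (intro sum.cong) auto
  have "(\<Sum>i=1..r+m. real_of_ereal (\<phi> i (z (Suc n) 0 i))) = (\<Sum>i=1..r+m. real_of_ereal (\<phi> i (z n wbar i)))"
    using restart[OF assms] by (intro sum.cong) auto
  then show "dual_value (Suc n) 0 = dual_value n wbar" by (simp add: dual_value_def v)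
  show "finite_at (Suc n) 0"
    using finite_at_end[OF assms] restart[OF assms] by (simp add: finite_at_def)
qed

text \<open>
  Later cycles only: they start where the previous one ended, hence with finite conjugates.
\<close>

lemma dual_value_cycle:
  assumes n: "n \<ge> 1" and w: "w \<le> wbar"
  shows "finite_at (Suc n) w" and
    "dual_value n wbar + (\<Sum>k=1..w. (norm (v (Suc n) k - v (Suc n) (k - 1)))\<^sup>2
        + (\<Sum>j\<in>active (Suc n) k. (norm (z (Suc n) k j - z (Suc n) (k - 1) j))\<^sup>2)) / 2
      \<le> dual_value (Suc n) w"
proof -
  let ?d = "\<lambda>k. (norm (v (Suc n) k - v (Suc n) (k - 1)))\<^sup>2
        + (\<Sum>j\<in>active (Suc n) k. (norm (z (Suc n) k j - z (Suc n) (k - 1) j))\<^sup>2)"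
  have "finite_at (Suc n) w \<and> dual_value n wbar + (\<Sum>k=1..w. ?d k) / 2 \<le> dual_value (Suc n) w"
    using w
  proof (induction w)
    case 0
    then show ?case using restart_eq[OF n] by simp
  next
    case (Suc w)
    then have w: "Suc w \<in> {1..wbar}" and fin: "finite_at (Suc n) (Suc w - 1)" by auto
    have "dual_value (Suc n) w + ?d (Suc w) / 2 \<le> dual_value (Suc n) (Suc w)"
      using dual_value_step[OF _ w fin] by (simp add: add_divide_distrib)
    moreover have "(\<Sum>k=1..Suc w. ?d k) = (\<Sum>k=1..w. ?d k) + ?d (Suc w)" by simp
    ultimately show ?case
      using Suc finite_at_step[OF _ w fin] by (simp add: add_divide_distrib)
  qed
  then show "finite_at (Suc n) w" "dual_value n wbar + (\<Sum>k=1..w. ?d k) / 2 \<le> dual_value (Suc n) w"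
    by blast+
qed

lemma increment_sq_nonneg: "increment_sq n \<ge> 0"
  unfolding increment_sq_def by (intro sum_nonneg add_nonneg_nonneg) auto

lemma increment_nonneg: "increment n \<ge> 0"
  unfolding increment_def by (intro sum_nonneg add_nonneg_nonneg) auto

lemma dual_value_Suc: "n \<ge> 1 \<Longrightarrow> dual_value n wbar + increment_sq (Suc n) / 2 \<le> dual_value (Suc n) wbar"
  using dual_value_cycle(2)[of n wbar] by (simp add: increment_sq_def)

lemma dual_value_mono:
  assumes "1 \<le> k" "k \<le> n"
  shows "dual_value k wbar \<le> dual_value n wbar"
  using assms(2,1)
proof (induction n rule: dec_induct)
  case (step n)
  then show ?case using dual_value_Suc[of n] increment_sq_nonneg[of "Suc n"] by simp
qed simp

text \<open>
  Cauchy--Schwarz, with at most \<open>wbar\<close> steps and at most \<open>m\<close> active blocks in each.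
\<close>

lemma increment_sq_bound: "(increment n)\<^sup>2 \<le> 2 * real wbar * (1 + real m) * increment_sq n"
proof -
  let ?dv = "\<lambda>w. norm (v n w - v n (w - 1))"
  let ?dz = "\<lambda>w j. norm (z n w j - z n (w - 1) j)"
  let ?d = "\<lambda>w. ?dv w + (\<Sum>j\<in>active n w. ?dz w j)"
  let ?e = "\<lambda>w. (?dv w)\<^sup>2 + (\<Sum>j\<in>active n w. (?dz w j)\<^sup>2)"
  have card: "card (active n w) \<le> m" for w
    by (rule order_trans[OF card_mono[of "{r+1..r+m}"]]) (auto simp: active_def)
  have d: "(?d w)\<^sup>2 \<le> 2 * (1 + real m) * ?e w" for w
  proof -
    let ?Q = "\<Sum>j\<in>active n w. (?dz w j)\<^sup>2"
    have "(\<Sum>j\<in>active n w. ?dz w j)\<^sup>2 \<le> ?Q * real (card (active n w))"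
      by (rule sum_squared_le_sum_of_squares)
    also have "\<dots> \<le> ?Q * real m"
      using card by (intro mult_left_mono) (auto simp: sum_nonneg)
    finally have Q: "(\<Sum>j\<in>active n w. ?dz w j)\<^sup>2 \<le> ?Q * real m" .
    have "(?d w)\<^sup>2 \<le> 2 * ((?dv w)\<^sup>2 + (\<Sum>j\<in>active n w. ?dz w j)\<^sup>2)"
      using sum_squares_bound[of "?dv w" "\<Sum>j\<in>active n w. ?dz w j"] by (simp add: power2_sum)
    also have "\<dots> \<le> 2 * ((1 + real m) * (?dv w)\<^sup>2 + (1 + real m) * ?Q)"
    proof -
      have "(?dv w)\<^sup>2 \<le> (1 + real m) * (?dv w)\<^sup>2" by (simp add: distrib_right)
      moreover have "?Q \<ge> 0" by (rule sum_nonneg) simp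
      then have "?Q * real m \<le> (1 + real m) * ?Q" by (simp add: distrib_right mult.commute)
      ultimately show ?thesis using Q by simp
    qed
    finally show ?thesis by (simp add: algebra_simps)
  qed
  have "(increment n)\<^sup>2 \<le> (\<Sum>w=1..wbar. (?d w)\<^sup>2) * real (card {1..wbar})"
    unfolding increment_def by (rule sum_squared_le_sum_of_squares)
  also have "\<dots> \<le> (\<Sum>w=1..wbar. 2 * (1 + real m) * ?e w) * real (card {1..wbar})"
  proof (rule mult_right_mono)
    show "(\<Sum>w=1..wbar. (?d w)\<^sup>2) \<le> (\<Sum>w=1..wbar. 2 * (1 + real m) * ?e w)"
      by (rule sum_mono) (rule d)
  qed simp
  also have "(\<Sum>w=1..wbar. 2 * (1 + real m) * ?e w) = 2 * (1 + real m) * increment_sq n"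
    unfolding increment_sq_def by (rule sum_distrib_left[symmetric])
  also have "2 * (1 + real m) * increment_sq n * real (card {1..wbar}) = 2 * real wbar * (1 + real m) * increment_sq n"
    by (simp add: mult.commute)
  finally show ?thesis .
qed

end

section \<open>Convergence\<close>

locale dykstra_feasible = dykstra_splitting +
  fixes a :: real
  assumes r: "1 \<le> r"
    and primal_value: "(INF y. primal_objective r h (\<lambda>x. (real m + 1) / 2 * (norm (x - x0))\<^sup>2) y) = ereal a"
    and growth: "(\<lambda>n. L2_set (\<lambda>i. norm (z n wbar i)) {1..r+m}) \<in> O(\<lambda>n. sqrt (real n))"
begin

abbreviation primal :: "'a \<Rightarrow> ereal" where
  "primal \<equiv> primal_objective r h (\<lambda>x. (real m + 1) / 2 * (norm (x - x0))\<^sup>2)"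

text \<open>
  Of the \<open>m + 1\<close> copies of the quadratic in \<open>g\<close>, \<open>m\<close> are the functions \<open>h j\<close> with \<open>j > r\<close>; one remains.
\<close>

lemma primal_eq: "primal y = (\<Sum>i=1..r+m. h i y) + ereal ((norm (y - x0))\<^sup>2 / 2)"
proof -
  have "(\<Sum>i=1..r+m. h i y) = (\<Sum>i=1..r. h i y) + (\<Sum>i=r+1..r+m. h i y)"
    using r by (subst sum.ub_add_nat) auto
  also have "(\<Sum>i=r+1..r+m. h i y) = (\<Sum>i=r+1..r+m. ereal (1 / 2 * (norm (y - x0))\<^sup>2))"
    using quadratic by (intro sum.cong) auto
  also have "\<dots> = ereal (real m / 2 * (norm (y - x0))\<^sup>2)"
    by simp
  finally show ?thesis
    by (simp add: primal_objective_def add.assoc add_divide_distrib distrib_right)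
qed

lemma primal_ge: "ereal a \<le> primal y"
  unfolding primal_value[symmetric] by (rule INF_lower) simp

text \<open>
  Besides the Fenchel inequalities of the summands, the gap contains a full square, which measures
  the distance of \<open>y\<close> to the primal point \<open>x0 - v\<close> attached to the dual iterate. It serves three purposes:
  boundedness of \<open>v\<close>, convergence of the whole sequence and uniqueness of the minimizer.
\<close>

lemma duality_gap:
  assumes fin: "finite_at n w"
  shows "ereal (dual_value n w + (norm (y - (x0 - v n w)))\<^sup>2 / 2) \<le> primal y"
proof -
  let ?c = "\<lambda>i. real_of_ereal (\<phi> i (z n w i))"
  have "ereal (z n w i \<bullet> y - ?c i) \<le> h i y" if "i \<in> {1..r+m}" for i
    using fin that h_not_MInf by (intro fenchel_young) (auto simp: finite_at_def ereal_real)
  then have "(\<Sum>i=1..r+m. ereal (z n w i \<bullet> y - ?c i)) \<le> (\<Sum>i=1..r+m. h i y)"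
    by (rule sum_mono)
  then have "ereal (v n w \<bullet> y - (\<Sum>i=1..r+m. ?c i)) \<le> (\<Sum>i=1..r+m. h i y)"
    by (simp add: sum_subtractf v_def inner_sum_left)
  then have "ereal (v n w \<bullet> y - (\<Sum>i=1..r+m. ?c i)) + ereal ((norm (y - x0))\<^sup>2 / 2) \<le> primal y"
    unfolding primal_eq by (rule add_right_mono)
  moreover have "v n w \<bullet> y - (\<Sum>i=1..r+m. ?c i) + (norm (y - x0))\<^sup>2 / 2
      = dual_value n w + (norm (y - (x0 - v n w)))\<^sup>2 / 2"
    using half_norm_sq_add[of "y - x0" "v n w"] half_norm_sq_diff[of x0 "v n w"]
    by (simp add: dual_value_def inner_diff_left inner_commute algebra_simps)
  ultimately show ?thesis by simp
qed

lemma dual_objective_eq: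
  assumes "finite_at n w"
  shows "dual_objective (r + m) h (\<lambda>x. (real m + 1) / 2 * (norm (x - x0))\<^sup>2) (1 / (real m + 1)) (z n w)
    = ereal (dual_value n w)"
proof -
  have "(\<Sum>i=1..r+m. \<phi> i (z n w i)) = (\<Sum>i=1..r+m. ereal (real_of_ereal (\<phi> i (z n w i))))"
    using assms by (intro sum.cong) (auto simp: finite_at_def ereal_real)
  then show ?thesis
    unfolding dual_objective_def penalty_eq by (simp add: dual_value_def v_def)
qed

lemma dual_value_le: "finite_at n w \<Longrightarrow> dual_value n w \<le> a"
proof -
  assume fin: "finite_at n w"
  have "ereal (dual_value n w) \<le> primal y" for y
  proof -
    have "ereal (dual_value n w) \<le> ereal (dual_value n w + (norm (y - (x0 - v n w)))\<^sup>2 / 2)" by simp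
    also have "\<dots> \<le> primal y" using fin by (rule duality_gap)
    finally show ?thesis .
  qed
  then have "ereal (dual_value n w) \<le> ereal a"
    unfolding primal_value[symmetric] by (intro INF_greatest)
  then show ?thesis by simp
qed

lemma feasible: obtains y b where "primal y = ereal b"
proof -
  have "\<exists>y. primal y \<noteq> \<infinity>"
  proof (rule ccontr)
    assume "\<not> ?thesis"
    then have "(INF y. primal y) = \<infinity>" by simp
    then show False using primal_value by simp
  qed
  then obtain y where "primal y \<noteq> \<infinity>" ..
  then show thesis using that primal_ge[of y] by (cases "primal y") auto
qed

lemma summable_increment_sq: "summable increment_sq"
proof -
  have "summable (\<lambda>n. increment_sq (n + 2))"
  proof (rule summableI_nonneg_bounded)
    fix N
    have "(\<Sum>k<N. increment_sq (k + 2)) \<le> 2 * (dual_value (Suc N) wbar - dual_value 1 wbar)"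
    proof (induction N)
      case (Suc N)
      then show ?case using dual_value_Suc[of "Suc N"] by simp
    qed simp
    also have "\<dots> \<le> 2 * (a - dual_value 1 wbar)"
      using dual_value_le[OF finite_at_end[of "Suc N"]] by simp
    finally show "(\<Sum>k<N. increment_sq (k + 2)) \<le> 2 * (a - dual_value 1 wbar)" .
  qed (rule increment_sq_nonneg)
  then show ?thesis by (simp only: summable_iff_shift)
qed

text \<open>
  From the second cycle on, the dual value stays above its value after the first cycle, so \<open>duality_gap\<close> at one
  fixed feasible point bounds \<open>v\<close>. During the first cycle the starting point may have dual
  value \<open>-\<infinity>\<close>; its finitely many iterates are added to the bound.
\<close>

lemma bounded_v:
  obtains C where "\<And>n w. n \<ge> 1 \<Longrightarrow> w \<in> {1..wbar} \<Longrightarrow> (norm (v n w))\<^sup>2 \<le> C"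
proof -
  obtain y b where y: "primal y = ereal b" by (rule feasible)
  define K where "K = 2 * (b - dual_value 1 wbar)"
  have tail: "norm (v n w) \<le> norm (y - x0) + sqrt K" if "n \<ge> 2" "w \<le> wbar" for n w
  proof -
    define k where "k = n - 1"
    have n: "n = Suc k" and k: "k \<ge> 1" using that by (auto simp: k_def)
    have fin: "finite_at n w" using dual_value_cycle(1)[OF k that(2)] n by simp
    have "dual_value 1 wbar \<le> dual_value k wbar" using k by (intro dual_value_mono) auto
    also have "\<dots> \<le> dual_value n w"
    proof -
      have "0 \<le> (\<Sum>i=1..w. (norm (v (Suc k) i - v (Suc k) (i - 1)))\<^sup>2
        + (\<Sum>j\<in>active (Suc k) i. (norm (z (Suc k) i j - z (Suc k) (i - 1) j))\<^sup>2))"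
        by (intro sum_nonneg add_nonneg_nonneg) auto
      then show ?thesis using dual_value_cycle(2)[OF k that(2)] unfolding n by linarith
    qed
    finally have "dual_value 1 wbar \<le> dual_value n w" .
    moreover have "dual_value n w + (norm (y - (x0 - v n w)))\<^sup>2 / 2 \<le> b"
      using duality_gap[OF fin, of y] y by simp
    ultimately have "(norm (y - (x0 - v n w)))\<^sup>2 \<le> K" by (simp add: K_def)
    then have "norm (y - (x0 - v n w)) \<le> sqrt K" by (rule real_le_rsqrt)
    moreover have "norm (v n w) \<le> norm (y - (x0 - v n w)) + norm (y - x0)"
      using norm_triangle_ineq4[of "y - (x0 - v n w)" "y - x0"] by simp
    ultimately show ?thesis by simp
  qed
  define C where "C = (norm (y - x0) + sqrt K)\<^sup>2 + (\<Sum>w=1..wbar. (norm (v 1 w))\<^sup>2)"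
  show thesis
  proof (rule that[of C])
    fix n w assume n: "n \<ge> (1::nat)" and w: "w \<in> {1..wbar}"
    have nonneg: "0 \<le> (\<Sum>w=1..wbar. (norm (v 1 w))\<^sup>2)" by (simp add: sum_nonneg)
    show "(norm (v n w))\<^sup>2 \<le> C"
    proof (cases "n = 1")
      case True
      then show ?thesis using member_le_sum[OF w, of "\<lambda>w. (norm (v 1 w))\<^sup>2"] by (simp add: C_def add_increasing)
    next
      case False
      then have "(norm (v n w))\<^sup>2 \<le> (norm (y - x0) + sqrt K)\<^sup>2"
        using n w by (intro power_mono tail) auto
      then show ?thesis using nonneg by (simp add: C_def)
    qed
  qed
qed

lemma wbar_pos: "wbar \<ge> 1"
proof -
  have "1 \<in> {1..r+m}" using r by simp
  then show ?thesis using ABC unfolding condition_ABC_def by force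
qed

text \<open>
  If \<open>(increment n)\<^sup>2\<close> were at least \<open>c / n\<close> for all large \<open>n\<close>, it would not be summable. A subsequence with the
  right rate is thinned out once more to make the bounded \<open>v\<close> converge.
\<close>

lemma good_subsequence:
  obtains s l where "strict_mono s" "\<And>k. s k \<ge> 1" "(\<lambda>k. v (s k) wbar) \<longlonglongrightarrow> l"
    "(\<lambda>k. increment (s k) * sqrt (real (s k))) \<longlonglongrightarrow> 0"
proof -
  let ?K = "2 * real wbar * (1 + real m)"
  have "summable (\<lambda>n. (increment n)\<^sup>2)"
    by (rule summable_comparison_test'[OF summable_mult[OF summable_increment_sq, of ?K]])
       (simp add: increment_sq_bound)
  then have ex: "\<exists>n\<ge>M. n \<ge> 1 \<and> real n * (increment n)\<^sup>2 < (1 / real (Suc k))\<^sup>2" for k M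
    by (rule summable_imp_small_multiple) simp
  obtain s where s: "strict_mono s"
      and sk: "\<And>k. s k \<ge> 1 \<and> real (s k) * (increment (s k))\<^sup>2 < (1 / real (Suc k))\<^sup>2"
    using strict_mono_selection[of "\<lambda>k n. n \<ge> 1 \<and> real n * (increment n)\<^sup>2 < (1 / real (Suc k))\<^sup>2"] ex
    by metis
  have "norm (increment (s k) * sqrt (real (s k))) \<le> 1 / real (Suc k)" for k
  proof -
    have "(increment (s k) * sqrt (real (s k)))\<^sup>2 \<le> (1 / real (Suc k))\<^sup>2"
      using sk[of k] by (simp add: power_mult_distrib mult.commute less_imp_le)
    then have "increment (s k) * sqrt (real (s k)) \<le> 1 / real (Suc k)"
      by (rule power2_le_imp_le) simp
    then show ?thesis by (simp add: increment_nonneg)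
  qed
  then have "\<forall>\<^sub>F k in sequentially. norm (increment (s k) * sqrt (real (s k))) \<le> 1 / real (Suc k)"
    by (rule always_eventually[OF allI])
  then have small: "(\<lambda>k. increment (s k) * sqrt (real (s k))) \<longlonglongrightarrow> 0"
    using LIMSEQ_inverse_real_of_nat[unfolded inverse_eq_divide] by (rule Lim_null_comparison)
  obtain C where C: "\<And>n w. n \<ge> 1 \<Longrightarrow> w \<in> {1..wbar} \<Longrightarrow> (norm (v n w))\<^sup>2 \<le> C"
    by (rule bounded_v) blast
  have "v (s k) wbar \<in> cball 0 (sqrt C)" for k
    using real_le_rsqrt[OF C[of "s k" wbar]] sk[of k] wbar_pos by simp
  then obtain l t where t: "strict_mono t" "((\<lambda>k. v (s k) wbar) \<circ> t) \<longlonglongrightarrow> l"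
    using compact_cball[of "0::'a" "sqrt C"] unfolding compact_eq_seq_compact_metric seq_compact_def by meson
  show thesis
  proof (rule that[of "s \<circ> t" l])
    show "strict_mono (s \<circ> t)" using s t(1) by (rule strict_mono_o)
    show "(s \<circ> t) k \<ge> 1" for k using sk by simp
    show "(\<lambda>k. v ((s \<circ> t) k) wbar) \<longlonglongrightarrow> l" using t(2) by (simp add: o_def)
    show "(\<lambda>k. increment ((s \<circ> t) k) * sqrt (real ((s \<circ> t) k))) \<longlonglongrightarrow> 0"
      using LIMSEQ_subseq_LIMSEQ[OF small t(1)] by (simp add: o_def)
  qed
qed

lemma dual_value_convergent: obtains L where "(\<lambda>n. dual_value n wbar) \<longlonglongrightarrow> L" "L \<le> a"
proof -
  have "incseq (\<lambda>n. dual_value (Suc n) wbar)"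
    by (intro incseq_SucI dual_value_mono) auto
  moreover have "dual_value (Suc n) wbar \<le> a" for n
    by (intro dual_value_le finite_at_end) simp
  ultimately obtain L where L: "(\<lambda>n. dual_value (Suc n) wbar) \<longlonglongrightarrow> L" "\<forall>n. dual_value (Suc n) wbar \<le> L"
    using incseq_convergent by metis
  have "L \<le> a" using L(1) by (rule LIMSEQ_le_const2) (auto intro!: dual_value_le finite_at_end)
  show thesis
  proof (rule that)
    show "(\<lambda>n. dual_value n wbar) \<longlonglongrightarrow> L"
      using L(1) by (rule iffD1[OF filterlim_sequentially_Suc])
    show "L \<le> a" by fact
  qed
qed

text \<open>
  The heart of the argument: along a subsequence on which the increments beat the growth of the
  dual iterates, the dual values approach the primal objective at the limit, so that weak duality is tight.
\<close>

lemma limit_attains_primal_value: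
  assumes s: "strict_mono s" "\<And>k. s k \<ge> 1" and l: "(\<lambda>k. v (s k) wbar) \<longlonglongrightarrow> l"
    and small: "(\<lambda>k. increment (s k) * sqrt (real (s k))) \<longlonglongrightarrow> 0"
  shows "primal (x0 - l) = ereal a" "(\<lambda>n. dual_value n wbar) \<longlonglongrightarrow> a"
proof -
  let ?N = "{1..r+m}"
  obtain L where L: "(\<lambda>n. dual_value n wbar) \<longlonglongrightarrow> L" "L \<le> a"
    by (rule dual_value_convergent)
  have DL: "(\<lambda>k. dual_value (s k) wbar) \<longlonglongrightarrow> L"
    using LIMSEQ_subseq_LIMSEQ[OF L(1) s(1)] by (simp add: o_def)
  have "\<forall>k. \<forall>i\<in>?N. \<exists>\<xi>. \<xi> \<in> subdifferential (\<phi> i) (z (s k) wbar i)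
      \<and> norm (\<xi> - (x0 - v (s k) wbar)) \<le> increment (s k)"
    using subgradient_near s(2) by blast
  then obtain \<xi> where \<xi>: "\<And>k i. i \<in> ?N \<Longrightarrow> \<xi> k i \<in> subdifferential (\<phi> i) (z (s k) wbar i)"
      and near: "\<And>k i. i \<in> ?N \<Longrightarrow> norm (\<xi> k i - (x0 - v (s k) wbar)) \<le> increment (s k)"
    by metis
  have inc0: "(\<lambda>k. increment (s k)) \<longlonglongrightarrow> 0"
  proof (rule Lim_null_comparison[OF _ small], rule always_eventually, rule allI)
    fix k
    have "increment (s k) * 1 \<le> increment (s k) * sqrt (real (s k))"
      using s(2)[of k] increment_nonneg by (intro mult_left_mono) auto
    then show "norm (increment (s k)) \<le> increment (s k) * sqrt (real (s k))"
      using increment_nonneg by simp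
  qed
  have \<xi>lim: "(\<lambda>k. \<xi> k i) \<longlonglongrightarrow> x0 - l" if "i \<in> ?N" for i
  proof -
    have "(\<lambda>k. \<xi> k i - (x0 - v (s k) wbar)) \<longlonglongrightarrow> 0"
      using near[OF that] by (intro Lim_null_comparison[OF _ inc0]) simp
    moreover have "(\<lambda>k. x0 - v (s k) wbar) \<longlonglongrightarrow> x0 - l" by (intro tendsto_intros l)
    ultimately show ?thesis using tendsto_add by fastforce
  qed
  \<comment> \<open>By Fenchel's equality \<open>u i k\<close> bounds \<open>h i\<close> at the subgradient \<open>\<xi> k i\<close>; \<open>err k\<close> is the cost of
      replacing all the subgradients by \<open>x0 - v\<close>.\<close>
  define c where "c k i = real_of_ereal (\<phi> i (z (s k) wbar i))" for k i
  define u where "u i k = z (s k) wbar i \<bullet> \<xi> k i - c k i" for i k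
  define err where "err k = (\<Sum>i\<in>?N. z (s k) wbar i \<bullet> (\<xi> k i - (x0 - v (s k) wbar)))" for k
  have c: "\<phi> i (z (s k) wbar i) = ereal (c k i)" if "i \<in> ?N" for i k
    using \<xi>[OF that, of k] by (simp add: subdifferential_def c_def ereal_real)
  have h_le: "h i (\<xi> k i) \<le> ereal (u i k)" if "i \<in> ?N" for i k
    unfolding u_def using proper_closed_convex[OF that] \<xi>[OF that] c[OF that]
    by (rule subdifferential_fenchel_conj_le)
  have err0: "err \<longlonglongrightarrow> 0"
  proof -
    obtain C where C: "C > 0"
      "\<forall>\<^sub>F n in sequentially. norm (L2_set (\<lambda>i. norm (z n wbar i)) ?N) \<le> C * norm (sqrt (real n))"
      using growth by (elim landau_o.bigE)
    have "\<forall>\<^sub>F k in sequentially. norm (L2_set (\<lambda>i. norm (z (s k) wbar i)) ?N) \<le> C * norm (sqrt (real (s k)))"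
      using eventually_subseq[OF s(1) C(2)] .
    then have "\<forall>\<^sub>F k in sequentially. norm (err k) \<le> real (r + m) * C * (increment (s k) * sqrt (real (s k)))"
    proof (rule eventually_mono)
      fix k assume le: "norm (L2_set (\<lambda>i. norm (z (s k) wbar i)) ?N) \<le> C * norm (sqrt (real (s k)))"
      have "norm (err k) \<le> (\<Sum>i\<in>?N. norm (z (s k) wbar i \<bullet> (\<xi> k i - (x0 - v (s k) wbar))))"
        unfolding err_def by (rule norm_sum)
      also have "\<dots> \<le> (\<Sum>i\<in>?N. C * sqrt (real (s k)) * increment (s k))"
      proof (rule sum_mono)
        fix i assume i: "i \<in> ?N"
        have "norm (z (s k) wbar i \<bullet> (\<xi> k i - (x0 - v (s k) wbar)))
            \<le> norm (z (s k) wbar i) * norm (\<xi> k i - (x0 - v (s k) wbar))"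
          using Cauchy_Schwarz_ineq2 by simp
        also have "\<dots> \<le> (C * sqrt (real (s k))) * increment (s k)"
        proof (rule mult_mono)
          have "norm (z (s k) wbar i) \<le> L2_set (\<lambda>i. norm (z (s k) wbar i)) ?N"
            using i by (intro member_le_L2_set) auto
          then show "norm (z (s k) wbar i) \<le> C * sqrt (real (s k))"
            using le by simp
        qed (use near[OF i] C in auto)
        finally show "norm (z (s k) wbar i \<bullet> (\<xi> k i - (x0 - v (s k) wbar))) \<le> C * sqrt (real (s k)) * increment (s k)" .
      qed
      finally show "norm (err k) \<le> real (r + m) * C * (increment (s k) * sqrt (real (s k)))"
        by (simp add: mult.assoc mult.left_commute mult.commute)
    qed
    moreover have "(\<lambda>k. real (r + m) * C * (increment (s k) * sqrt (real (s k)))) \<longlonglongrightarrow> 0"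
      using tendsto_mult_right_zero[OF small] by simp
    ultimately show ?thesis by (rule Lim_null_comparison)
  qed
  have usum: "(\<Sum>i\<in>?N. u i k) = dual_value (s k) wbar - (norm (v (s k) wbar))\<^sup>2 / 2 + err k" for k
  proof -
    have "err k = (\<Sum>i\<in>?N. z (s k) wbar i \<bullet> \<xi> k i) - v (s k) wbar \<bullet> (x0 - v (s k) wbar)"
      by (simp add: err_def inner_diff_right sum_subtractf v_def inner_sum_left)
    moreover have "(\<Sum>i\<in>?N. u i k) = (\<Sum>i\<in>?N. z (s k) wbar i \<bullet> \<xi> k i) - (\<Sum>i\<in>?N. c k i)"
      by (simp add: u_def sum_subtractf)
    moreover have "v (s k) wbar \<bullet> (x0 - v (s k) wbar) = x0 \<bullet> v (s k) wbar - (norm (v (s k) wbar))\<^sup>2"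
      by (simp add: inner_diff_right power2_norm_eq_inner inner_commute)
    ultimately show ?thesis
      using half_norm_sq_diff[of x0 "v (s k) wbar"] unfolding dual_value_def c_def by linarith
  qed
  have "(\<lambda>k. \<Sum>i\<in>?N. u i k) \<longlonglongrightarrow> L - (norm l)\<^sup>2 / 2 + 0"
    unfolding usum by (intro tendsto_intros DL l err0) simp
  then have "(\<lambda>k. \<Sum>i\<in>?N. u i k) \<longlonglongrightarrow> L - (norm l)\<^sup>2 / 2" by simp
  then have "(\<Sum>i\<in>?N. h i (x0 - l)) \<le> ereal (L - (norm l)\<^sup>2 / 2)"
  proof (rule sum_le_of_lower_semicontinuous_limits[rotated -1])
    fix i t assume i: "i \<in> ?N" and t: "ereal t < h i (x0 - l)"
    have "\<forall>\<^sub>F k in sequentially. ereal t < h i (\<xi> k i)"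
      using proper_closed_convex(2)[OF i] \<xi>lim[OF i] t by (rule closed_fun_less_eventually)
    then show "\<forall>\<^sub>F k in sequentially. t < u i k"
    proof (rule eventually_mono)
      fix k assume "ereal t < h i (\<xi> k i)"
      then have "ereal t < ereal (u i k)" using h_le[OF i, of k] by (rule less_le_trans)
      then show "t < u i k" by simp
    qed
  qed (use h_not_MInf in auto)
  then have "primal (x0 - l) \<le> ereal (L - (norm l)\<^sup>2 / 2) + ereal ((norm (x0 - l - x0))\<^sup>2 / 2)"
    unfolding primal_eq by (rule add_right_mono)
  then have "primal (x0 - l) \<le> ereal L" by simp
  note le = this
  have "ereal a \<le> ereal L" using primal_ge le by (rule order_trans)
  then have "L = a" using L(2) by simp
  then show "primal (x0 - l) = ereal a" "(\<lambda>n. dual_value n wbar) \<longlonglongrightarrow> a"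
    using le primal_ge[of "x0 - l"] L(1) by auto
qed

text \<open>
  With the dual values tending to the primal value, the gap at a minimizer, and with it the square it
  contains, tends to zero.
\<close>

lemma minimizer_is_limit:
  assumes D: "(\<lambda>n. dual_value n wbar) \<longlonglongrightarrow> a" and y: "primal y \<le> ereal a"
  shows "(\<lambda>n. x0 - v n wbar) \<longlonglongrightarrow> y"
proof -
  have "norm (x0 - v n wbar - y) \<le> sqrt (2 * (a - dual_value n wbar))" if "n \<ge> 1" for n
  proof (rule real_le_rsqrt)
    have "ereal (dual_value n wbar + (norm (y - (x0 - v n wbar)))\<^sup>2 / 2) \<le> ereal a"
      using duality_gap[OF finite_at_end[OF that]] y by (rule order_trans)
    then show "(norm (x0 - v n wbar - y))\<^sup>2 \<le> 2 * (a - dual_value n wbar)"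
      by (simp add: norm_minus_commute)
  qed
  then have "\<forall>\<^sub>F n in sequentially. norm (x0 - v n wbar - y) \<le> sqrt (2 * (a - dual_value n wbar))"
    using eventually_sequentially by blast
  moreover have "(\<lambda>n. sqrt (2 * (a - dual_value n wbar))) \<longlonglongrightarrow> 0"
    using tendsto_real_sqrt[OF tendsto_mult_left[OF tendsto_diff[OF tendsto_const D]], of 2 a] by simp
  ultimately have "(\<lambda>n. x0 - v n wbar - y) \<longlonglongrightarrow> 0"
    by (rule Lim_null_comparison)
  then show ?thesis by (simp only: LIM_zero_iff)
qed

text \<open>
  Two minimizers are limits of one and the same sequence.
\<close>

lemma primal_minimizers:
  assumes D: "(\<lambda>n. dual_value n wbar) \<longlonglongrightarrow> a" and y: "primal y = ereal a"
  shows "{u. is_arg_min primal (\<lambda>_. True) u} = {y}"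
proof
  show "{y} \<subseteq> {u. is_arg_min primal (\<lambda>_. True) u}"
    using y primal_ge by (auto simp: is_arg_min_def not_less)
  show "{u. is_arg_min primal (\<lambda>_. True) u} \<subseteq> {y}"
  proof
    fix u assume "u \<in> {u. is_arg_min primal (\<lambda>_. True) u}"
    then have "primal u \<le> ereal a"
      using y by (auto simp: is_arg_min_def not_less dest: spec[of _ y])
    then show "u \<in> {y}"
      using LIMSEQ_unique[OF minimizer_is_limit[OF D, of u] minimizer_is_limit[OF D, of y]] y by simp
  qed
qed

end

theorem theorem4p5:
  fixes x0 :: "'a::euclidean_space"
    and r m wbar :: nat
    and h :: "nat \<Rightarrow> 'a \<Rightarrow> ereal"
    and g :: "'a \<Rightarrow> real"
    and lam :: "nat \<Rightarrow> real"
    and S :: "nat \<Rightarrow> nat \<Rightarrow> nat set"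
    and S' :: "nat \<Rightarrow> nat \<Rightarrow> nat \<Rightarrow> nat set"
    and z :: "nat \<Rightarrow> nat \<Rightarrow> nat \<Rightarrow> 'a"
    and \<alpha> \<beta> :: ereal
    and F :: "(nat \<Rightarrow> 'a) \<Rightarrow> ereal"
    and v x :: "nat \<Rightarrow> nat \<Rightarrow> 'a"
    and \<gamma> :: "nat \<Rightarrow> real"
  assumes r: "r \<ge> 1"
    and wbar: "wbar \<ge> 1"
    and h: "\<forall>i\<in>{1..r}. proper_fun (h i) \<and> closed_fun (h i) \<and> convex_fun (h i)"
    and g: "g = (\<lambda>x. (real m + 1) / 2 * (norm (x - x0))\<^sup>2)"
    and lam: "\<forall>i\<in>{0..m}. lam i = 1 / (real m + 1)"
    and hj: "\<forall>j\<in>{r+1..r+m}. h j = (\<lambda>x. ereal (lam (j - r) * g x))"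
    and F: "F = dual_objective (r + m) h g (lam 0)"
    and alg: "algorithm_A (r + m) h g (lam 0) wbar S z"
    and proc: "procedure_I r m h wbar S S' z"
    and ABC: "condition_ABC r m wbar S S'"
    and \<alpha>: "\<alpha> = (INF x. primal_objective r h g x)"
    and \<alpha>_finite: "\<bar>\<alpha>\<bar> \<noteq> \<infinity>"
    and \<beta>: "\<beta> = (SUP y. F y)"
    and growth: "(\<lambda>n. L2_set (\<lambda>i. norm (z n wbar i)) {1..r+m}) \<in> O(\<lambda>n. sqrt (real n))"
    and v: "v = (\<lambda>n w. \<Sum>i=1..r+m. z n w i)"
    and x: "x = (\<lambda>n w. x0 - v n w)"
    and \<gamma>: "\<gamma> = (\<lambda>n. \<Sum>w=1..wbar. norm (v n w - v n (w - 1)) +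
               (\<Sum>j | j \<in> {r+1..r+m} \<and> S' n w j \<noteq> {}. norm (z n w j - z n (w - 1) j)))"
  shows
    "(\<comment> \<open>(i)\<close> (\<lambda>n. \<Sum>w=1..wbar. (norm (v n w - v n (w - 1)))\<^sup>2 +
        (\<Sum>j | j \<in> {r+1..r+m} \<and> S' n w j \<noteq> {}. (norm (z n w j - z n (w - 1) j))\<^sup>2))
      summable_on {1..}
     \<and> mono_on {1..} (\<lambda>n. F (z n wbar)))
     \<and>
     (\<comment> \<open>(ii)\<close> \<exists>C::real. \<forall>n\<ge>1. \<forall>w\<in>{1..wbar}. (norm (v n w))\<^sup>2 \<le> C)
     \<and>
     (\<comment> \<open>(iii)\<close> \<exists>s vstar. strict_mono s \<and> (\<forall>k. s k \<ge> 1) \<and>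
        (\<lambda>k. v (s k) wbar) \<longlonglongrightarrow> vstar \<and> (\<lambda>k. \<gamma> (s k) * sqrt (real (s k))) \<longlonglongrightarrow> 0)
     \<and>
     (\<comment> \<open>(iv)\<close> \<forall>i\<in>{1..r+m}. \<forall>n\<ge>1. \<exists>xi\<in>subdifferential (fenchel_conj (h i)) (z n wbar i).
        norm (xi - (x0 - v n wbar)) \<le> \<gamma> n)
     \<and>
     (\<comment> \<open>(v), for every subsequence and limit as in (iii)\<close>
      \<forall>s vstar. strict_mono s \<and> (\<forall>k. s k \<ge> 1) \<and>
        (\<lambda>k. v (s k) wbar) \<longlonglongrightarrow> vstar \<and> (\<lambda>k. \<gamma> (s k) * sqrt (real (s k))) \<longlonglongrightarrow> 0 \<longrightarrow>
          {y. is_arg_min (primal_objective r h g) (\<lambda>_. True) y} = {x0 - vstar} \<and>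
          (\<lambda>k. F (z (s k) wbar)) \<longlonglongrightarrow>
            ereal (1 / 2 * (norm vstar)\<^sup>2) + (\<Sum>i=1..r+m. h i (x0 - vstar)))
     \<and>
     (\<comment> \<open>full sequence; the minimality of \<open>x0 - vstar\<close> is part of (v)\<close>
      convergent (\<lambda>n. x n wbar))"
proof -
  define a where "a = real_of_ereal \<alpha>"
  have lam0: "lam 0 = 1 / (real m + 1)" using lam by simp
  have hj': "h j = (\<lambda>x. ereal (1 / 2 * (norm (x - x0))\<^sup>2))" if j: "j \<in> {r+1..r+m}" for j
  proof -
    have "j - r \<in> {0..m}" using j by auto
    then have l: "lam (j - r) = 1 / (real m + 1)" using lam by blast
    have "h j = (\<lambda>x. ereal (lam (j - r) * g x))" using hj j by blast
    also have "\<dots> = (\<lambda>x. ereal (1 / 2 * (norm (x - x0))\<^sup>2))" unfolding l g by simp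
    finally show ?thesis .
  qed
  interpret D: dykstra_feasible x0 r m wbar h S S' z a
  proof
    show "proper_fun (h i) \<and> closed_fun (h i) \<and> convex_fun (h i)" if "i \<in> {1..r}" for i
      using h that by blast
    show "algorithm_A (r + m) h (\<lambda>x. (real m + 1) / 2 * (norm (x - x0))\<^sup>2) (1 / (real m + 1)) wbar S z"
      using alg unfolding lam0 g .
    show "(INF y. primal_objective r h (\<lambda>x. (real m + 1) / 2 * (norm (x - x0))\<^sup>2) y) = ereal a"
      using \<alpha> \<alpha>_finite unfolding g a_def by (simp add: ereal_real)
  qed (fact hj' proc ABC r growth)+
  \<comment> \<open>The sequences of the statement are those of the abstract setting.\<close>
  have v_eq: "v = D.v" unfolding v by (intro ext) (simp add: D.v_def)
  have sq_eq: "(\<lambda>n. \<Sum>w=1..wbar. (norm (v n w - v n (w - 1)))\<^sup>2 +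
        (\<Sum>j | j \<in> {r+1..r+m} \<and> S' n w j \<noteq> {}. (norm (z n w j - z n (w - 1) j))\<^sup>2)) = D.increment_sq"
    unfolding v_eq D.increment_sq_def D.active_def by (rule refl)
  have \<gamma>_eq: "\<gamma> = D.increment"
    unfolding \<gamma> v_eq D.increment_def D.active_def by (rule refl)
  have F_eq: "F (z n wbar) = ereal (D.dual_value n wbar)" if "n \<ge> 1" for n
    unfolding F lam0 g by (rule D.dual_objective_eq) (rule D.finite_at_end[OF that])
  have P_eq: "primal_objective r h g = D.primal" unfolding g ..
  have ascent: "D.increment_sq summable_on {1..} \<and> mono_on {1..} (\<lambda>n. F (z n wbar))"
  proof
    have "D.increment_sq summable_on UNIV"
      using D.summable_increment_sq D.increment_sq_nonneg by (intro norm_summable_imp_summable_on) simp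
    then show "D.increment_sq summable_on {1..}" by (rule summable_on_subset_banach) simp
    show "mono_on {1..} (\<lambda>n. F (z n wbar))"
      by (intro mono_onI) (simp add: F_eq D.dual_value_mono)
  qed
  obtain C where C: "\<And>n w. n \<ge> 1 \<Longrightarrow> w \<in> {1..wbar} \<Longrightarrow> (norm (D.v n w))\<^sup>2 \<le> C"
    by (rule D.bounded_v) blast
  obtain s l where s: "strict_mono s" "\<And>k. s k \<ge> 1" and l: "(\<lambda>k. D.v (s k) wbar) \<longlonglongrightarrow> l"
      and small: "(\<lambda>k. D.increment (s k) * sqrt (real (s k))) \<longlonglongrightarrow> 0"
    by (rule D.good_subsequence) blast
  note lim = D.limit_attains_primal_value[OF s l small]
  have "(\<lambda>n. x0 - D.v n wbar) \<longlonglongrightarrow> x0 - l"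
    by (rule D.minimizer_is_limit[OF lim(2)]) (simp only: lim(1) order_refl)
  then have full: "convergent (\<lambda>n. x n wbar)"
    unfolding x v_eq by (rule convergentI)
  have limits: "{y. is_arg_min (primal_objective r h g) (\<lambda>_. True) y} = {x0 - vstar} \<and>
      (\<lambda>k. F (z (t k) wbar)) \<longlonglongrightarrow>
        ereal (1 / 2 * (norm vstar)\<^sup>2) + (\<Sum>i=1..r+m. h i (x0 - vstar))"
    if t: "strict_mono t" "\<And>k. t k \<ge> 1" "(\<lambda>k. D.v (t k) wbar) \<longlonglongrightarrow> vstar"
      "(\<lambda>k. D.increment (t k) * sqrt (real (t k))) \<longlonglongrightarrow> 0" for t vstar
  proof
    note lim = D.limit_attains_primal_value[OF t]
    show "{y. is_arg_min (primal_objective r h g) (\<lambda>_. True) y} = {x0 - vstar}"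
      unfolding P_eq by (rule D.primal_minimizers[OF lim(2,1)])
    have "(\<lambda>k. D.dual_value (t k) wbar) \<longlonglongrightarrow> a"
      using LIMSEQ_subseq_LIMSEQ[OF lim(2) t(1)] by (simp add: o_def)
    then have "(\<lambda>k. F (z (t k) wbar)) \<longlonglongrightarrow> ereal a"
      using F_eq[OF t(2)] by simp
    moreover have "ereal a = ereal (1 / 2 * (norm vstar)\<^sup>2) + (\<Sum>i=1..r+m. h i (x0 - vstar))"
      using lim(1) unfolding D.primal_eq by (simp add: add.commute)
    ultimately show "(\<lambda>k. F (z (t k) wbar)) \<longlonglongrightarrow>
        ereal (1 / 2 * (norm vstar)\<^sup>2) + (\<Sum>i=1..r+m. h i (x0 - vstar))" by simp
  qed
  show ?thesis
    unfolding sq_eq unfolding v_eq \<gamma>_eq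
  proof (intro conjI)
    show "D.increment_sq summable_on {1..}" "mono_on {1..} (\<lambda>n. F (z n wbar))" using ascent by blast+
    show "\<exists>C. \<forall>n\<ge>1. \<forall>w\<in>{1..wbar}. (norm (D.v n w))\<^sup>2 \<le> C" using C by blast
    show "\<exists>s vstar. strict_mono s \<and> (\<forall>k. s k \<ge> 1) \<and> (\<lambda>k. D.v (s k) wbar) \<longlonglongrightarrow> vstar \<and>
        (\<lambda>k. D.increment (s k) * sqrt (real (s k))) \<longlonglongrightarrow> 0"
      using s l small by blast
    show "\<forall>i\<in>{1..r+m}. \<forall>n\<ge>1. \<exists>xi\<in>subdifferential (fenchel_conj (h i)) (z n wbar i).
        norm (xi - (x0 - D.v n wbar)) \<le> D.increment n"
      using D.subgradient_near by blast
    show "convergent (\<lambda>n. x n wbar)" by (rule full)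
  qed (use limits in blast)
qed

end
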